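(* Let $\mathbb{L}$ be a field of characteristic $p>0$ and fix an $\mathbb{N}$-grading on $\mathbb{L}[x_1,\dots,x_n]$. Let $f$ be a homogeneous polynomial with $\sqrt{\operatorname{Jac}(f)}=\mathfrak{m}=(x_1,\dots,x_n)$, and write $\lambda:=\min\left\{\frac{\sum\deg x_i}{\deg f},1\right\}=\frac ab$ in lowest terms. Suppose $\operatorname{fpt}(f)\ne\lambda$. Then there is a pair $(L,E)\in\mathbb{N}^2$ such that: (1) $L\ge1$, $\ 0\le E\le n-1-\left\lceil\frac{[\,a p^L\ \%\ b\,]+a}{b}\right\rceil$, and $$\operatorname{fpt}(f)=\lambda-\left(\frac{[\,a p^L\ \%\ b\,]+bE}{b\,p^L}\right)=\langle\lambda\rangle_L-\frac{E}{p^L}.$$ (2) If $p>(n-2)\cdot b$ and $p\nmid b$, then $1\le L\le\operatorname{ord}(p,b)$. (3) If $p>(n-2)\cdot b$ and $p>b$, then $a<[\,a p^e\ \%\ b\,]$ for all $1\le e\le L-1$. (4) If $p>(n-1)\cdot b$, then there is a unique pair $(L,E)\in\mathbb{N}^2$ satisfying the conclusions of (1).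
   Context: $\mathbb{N}$ includes $0$. An $\mathbb{N}$-grading on a polynomial ring over a field is a grading in which field elements have degree $0$ and each variable has a positive integer degree; homogeneous polynomials are taken nonzero. $\operatorname{Jac}(f)$ is the ideal generated by the partial derivatives of $f$. For integers $m$ and $b>0$, $[\,m\ \%\ b\,]$ is the least positive residue of $m$ modulo $b$, so $1\le[\,m\ \%\ b\,]\le b$. For $p\nmid b$, $\operatorname{ord}(p,b)$ is the least integer $k\ge1$ with $p^k\equiv1\bmod b$ (so $\operatorname{ord}(p,1)=1$). For $\alpha\in(0,1]$, write its unique non-terminating base $p$ expansion $\alpha=\sum_{e\ge1}\alpha^{(e)}p^{-e}$ (integers $0\le\alpha^{(e)}\le p-1$, not all eventually zero), and set $\langle\alpha\rangle_L=\sum_{e=1}^L\alpha^{(e)}p^{-e}$. With $\mathfrak{m}^{[p^e]}=(x_1^{p^e},\dots,x_n^{p^e})$ and $f\in\mathfrak{m}$, set $\nu_f(p^e)=\max\{N:f^N\notin\mathfrak{m}^{[p^e]}\}$; the $F$-pure threshold is $\operatorname{fpt}(f)=\lim_{e\to\infty}\nu_f(p^e)/p^e$ (the limit exists). *)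

theory Defs
  imports
    "HOL-Analysis.Analysis"
    "HOL-Library.Poly_Mapping"
    "HOL-Number_Theory.Number_Theory"
begin

text \<open>
  The polynomial ring over \<open>'a\<close> in the variables indexed by the finite type \<open>'n\<close> is the type
  \<open>('n \<Rightarrow>\<^sub>0 nat) \<Rightarrow>\<^sub>0 'a\<close>: exponent vectors are finitely supported functions \<open>'n \<Rightarrow>\<^sub>0 nat\<close>, and
  \<open>Poly_Mapping.lookup f m\<close> is the coefficient of \<open>f\<close> at the monomial with exponent vector \<open>m\<close>. The number
  of variables is \<open>CARD('n)\<close>.
\<close>

type_synonym ('n, 'a) mpoly = "('n \<Rightarrow>\<^sub>0 nat) \<Rightarrow>\<^sub>0 'a"

definition Var :: "'n \<Rightarrow> ('n, 'a::field) mpoly" where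
  "Var i = Poly_Mapping.single (Poly_Mapping.single i 1) 1"

definition partial_deriv :: "'n \<Rightarrow> ('n, 'a::field) mpoly \<Rightarrow> ('n, 'a) mpoly" where
  "partial_deriv i f =
     (\<Sum>m\<in>Poly_Mapping.keys f. Poly_Mapping.single (m - Poly_Mapping.single i 1)
                     (of_nat (Poly_Mapping.lookup m i) * Poly_Mapping.lookup f m))"

lemma module_self: "Modules.module ((*) :: 'r::comm_ring_1 \<Rightarrow> 'r \<Rightarrow> 'r)"
  by (rule Modules.module.intro) (simp_all add: algebra_simps)

text \<open>The generated ideal is the span in the ring regarded as a module over itself.\<close>

definition ideal_gen :: "'r::comm_ring_1 set \<Rightarrow> 'r set" where
  "ideal_gen S = Modules.module.span (*) S"

lemma ideal_gen_explicit:
  "ideal_gen S = {(\<Sum>s\<in>T. r s * s) | T r. finite T \<and> T \<subseteq> S}"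
  unfolding ideal_gen_def by (rule Modules.module.span_explicit[OF module_self])

definition ideal_radical :: "'r::comm_ring_1 set \<Rightarrow> 'r set" where
  "ideal_radical I = {g. \<exists>k\<ge>1. g ^ k \<in> I}"

definition max_ideal :: "('n::finite, 'a::field) mpoly set" where
  "max_ideal = ideal_gen (range Var)"

definition Jac :: "('n::finite, 'a::field) mpoly \<Rightarrow> ('n, 'a) mpoly set" where
  "Jac f = ideal_gen (range (\<lambda>i. partial_deriv i f))"

text \<open>
  A grading is given by the degrees \<open>w i\<close> of the variables; the statement assumes them positive.
\<close>

definition homogeneous :: "('n::finite \<Rightarrow> nat) \<Rightarrow> nat \<Rightarrow> ('n, 'a::field) mpoly \<Rightarrow> bool" where
  "homogeneous w d f \<longleftrightarrow> f \<noteq> 0 \<and> (\<forall>m\<in>Poly_Mapping.keys f. (\<Sum>i\<in>UNIV. w i * Poly_Mapping.lookup m i) = d)"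

definition frobenius_ideal :: "nat \<Rightarrow> ('n::finite, 'a::field) mpoly set" where
  "frobenius_ideal q = ideal_gen (range (\<lambda>i. Var i ^ q))"

text \<open>
  Both \<open>nu\<close> and \<open>fpt\<close> are only meaningful for \<open>f \<in> max_ideal\<close> and positive characteristic; for
  such \<open>f\<close> and \<open>q\<close> a power of \<open>CHAR('a)\<close> the set below is finite and contains \<open>0\<close>.
\<close>

definition nu :: "('n::finite, 'a::field) mpoly \<Rightarrow> nat \<Rightarrow> nat" where
  "nu f q = Max {N. f ^ N \<notin> frobenius_ideal q}"

definition fpt :: "('n::finite, 'a::field) mpoly \<Rightarrow> real" where
  "fpt f = lim (\<lambda>e. real (nu f (CHAR('a) ^ e)) / real (CHAR('a) ^ e))"

definition least_pos_residue :: "int \<Rightarrow> nat \<Rightarrow> nat" where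
  "least_pos_residue m b = (LEAST r::nat. 1 \<le> r \<and> [int r = m] (mod int b))"

text \<open>
  The non-terminating base \<open>p\<close> expansion of a number in \<open>{0<..1}\<close>. The digits are indexed by
  \<open>e \<ge> 1\<close>; the value at \<open>0\<close> is set to \<open>0\<close> so that the digit function is unique.
\<close>

definition nonterm_digits :: "nat \<Rightarrow> real \<Rightarrow> nat \<Rightarrow> nat" where
  "nonterm_digits p \<alpha> =
     (THE c. c 0 = 0 \<and> (\<forall>e\<ge>1. c e \<le> p - 1) \<and> (\<forall>N. \<exists>e\<ge>N. c e \<noteq> 0) \<and>
             (\<lambda>e. real (c e) / real p ^ e) sums \<alpha>)"

definition base_trunc :: "nat \<Rightarrow> real \<Rightarrow> nat \<Rightarrow> real" where
  "base_trunc p \<alpha> L = (\<Sum>e=1..L. real (nonterm_digits p \<alpha> e) / real p ^ e)"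

end

theory Submission
  imports Defs
begin

text \<open>
  Put \<open>\<sigma> = \<Sum>i. w i\<close>, \<open>q = p ^ e\<close> and \<open>\<nu> e = nu f q\<close>. Since \<open>f ^ N\<close> is homogeneous of degree
  \<open>N * d\<close>, having a monomial with all exponents below \<open>q\<close> forces \<open>N * d \<le> (q - 1) * \<sigma>\<close>, so
  \<open>\<nu> e \<le> (q - 1) * lam\<close>. In the other direction, suppose that \<open>e \<ge> 1\<close> and \<open>p\<close> does not divide \<open>\<nu> e + 1\<close>. The ideal
  \<open>frobenius_ideal q\<close> is closed under partial derivatives, so differentiating
  \<open>f ^ (\<nu> e + 1) \<in> frobenius_ideal q\<close> shows that \<open>Jac f\<close> multiplies \<open>f ^ \<nu> e\<close> into it. A monomial
  \<open>x ^ \<mu>\<close> of \<open>f ^ \<nu> e\<close> outside the Frobenius ideal then yields a monomial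
  \<open>x ^ (q - 1 - \<mu>)\<close> outside \<open>Jac f\<close>, of weight \<open>(q - 1) * \<sigma> - \<nu> e * d\<close>. But \<open>Jac f\<close> is generated by
  \<open>n\<close> forms of degrees \<open>d - w i\<close> and contains a power of every variable, so it contains everything of
  weight above \<open>\<Sum>i. (d - 2 * w i)\<close>, the socle degree of a graded complete intersection. This gives
  \<open>(q + 1) * lam \<le> \<nu> e + n\<close> (lemma \<open>isolated_singularity_power_bound\<close>).

  The socle degree bound (lemma \<open>complete_intersection_top_degree\<close>) follows from the Frobenius
  endomorphism rather than from a theory of regular sequences. If \<open>x ^ \<eta>\<close> lies outside
  \<open>J = (g\<^sub>1, \<dots>, g\<^sub>n)\<close>, a splitting of Frobenius shows that \<open>x ^ (q * \<eta> + (q - 1))\<close> lies outside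
  \<open>(g\<^sub>1 ^ q, \<dots>, g\<^sub>n ^ q)\<close>; yet rewriting an element repeatedly in terms of the \<open>g\<^sub>i\<close> puts every form of
  weight above \<open>M + (q - 1) * \<Sum>i. e i\<close>, with \<open>M\<close> independent of \<open>q\<close>, into that ideal. Comparing
  weights and letting \<open>q\<close> grow gives the bound.

  What remains is arithmetic of the sequence \<open>\<nu>\<close> (locale \<open>threshold_sequence\<close>), which also satisfies
  \<open>\<nu> s + p ^ s * \<nu> e \<le> \<nu> (s + e)\<close> and \<open>\<nu> (s + e) + 1 \<le> p ^ s * (\<nu> e + 1)\<close>. As \<open>fpt f < lam\<close>, the gap
  between \<open>q * lam\<close> and \<open>\<nu> e\<close> grows like \<open>q\<close>, so the lower bound fails for large \<open>e\<close> and there is a last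
  \<open>L \<ge> 1\<close> with \<open>p\<close> not dividing \<open>\<nu> L + 1\<close>. Beyond \<open>L\<close> every step is forced to be
  \<open>\<nu> (e + 1) + 1 = p * (\<nu> e + 1)\<close>, whence \<open>fpt f = (\<nu> L + 1) / p ^ L\<close>, and the two bounds at \<open>L\<close> turn
  into the description of \<open>E\<close>. For large \<open>p\<close> the sequence \<open>\<nu>\<close> agrees with the truncations of \<open>lam\<close>
  below \<open>L\<close>, and a residue returning to the value \<open>a\<close> there would force \<open>fpt f = lam\<close>; this gives
  the bound on \<open>L\<close> and the inequalities between residues. For \<open>p > (n - 1) * b\<close> every admissible
  numerator \<open>[a * p ^ L % b] + b * E\<close> is smaller than \<open>p\<close>, so the value of \<open>lam - fpt f\<close> determines the
  denominator \<open>b * p ^ L\<close> and with it the pair.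
\<close>

section \<open>Monomials, coefficients and Frobenius powers\<close>

abbreviation coeff :: "('n, 'a::zero) mpoly \<Rightarrow> ('n \<Rightarrow>\<^sub>0 nat) \<Rightarrow> 'a" where
  "coeff \<equiv> Poly_Mapping.lookup"

abbreviation exponent :: "('n \<Rightarrow>\<^sub>0 nat) \<Rightarrow> 'n \<Rightarrow> nat" where
  "exponent \<equiv> Poly_Mapping.lookup"

abbreviation monomials :: "('n, 'a::zero) mpoly \<Rightarrow> ('n \<Rightarrow>\<^sub>0 nat) set" where
  "monomials \<equiv> Poly_Mapping.keys"

abbreviation term_of :: "('n \<Rightarrow>\<^sub>0 nat) \<Rightarrow> 'a::zero \<Rightarrow> ('n, 'a) mpoly" where
  "term_of \<equiv> Poly_Mapping.single"

definition expo :: "('n::finite \<Rightarrow> nat) \<Rightarrow> ('n \<Rightarrow>\<^sub>0 nat)" where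
  "expo f = Abs_poly_mapping f"

definition scale_expo :: "nat \<Rightarrow> ('n::finite \<Rightarrow>\<^sub>0 nat) \<Rightarrow> ('n \<Rightarrow>\<^sub>0 nat)" where
  "scale_expo q m = expo (\<lambda>i. q * exponent m i)"

lemma exponent_expo [simp]: "exponent (expo f) i = f i"
  by (simp add: expo_def)

lemma exponent_scale [simp]: "exponent (scale_expo q m) i = q * exponent m i"
  by (simp add: scale_expo_def)

lemma expo_eqI: "(\<And>i. exponent m i = exponent m' i) \<Longrightarrow> m = m'"
  by (simp add: poly_mapping_eqI)

lemma sum_terms: "(\<Sum>m\<in>monomials h. term_of m (coeff h m)) = h"
proof (rule poly_mapping_eqI)
  fix k
  have "coeff (\<Sum>m\<in>monomials h. term_of m (coeff h m)) k
      = (\<Sum>m\<in>monomials h. if m = k then coeff h k else 0)"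
    unfolding lookup_sum by (intro sum.cong refl) (auto simp: lookup_single when_def)
  also have "\<dots> = coeff h k"
    by (auto simp: in_keys_iff)
  finally show "coeff (\<Sum>m\<in>monomials h. term_of m (coeff h m)) k = coeff h k" .
qed

lemma mult_eq_sum_terms:
  fixes f g :: "('n, 'a::comm_ring_1) mpoly"
  shows "f * g = (\<Sum>a\<in>monomials f. \<Sum>b\<in>monomials g. term_of (a + b) (coeff f a * coeff g b))"
proof -
  have "f * g = (\<Sum>a\<in>monomials f. term_of a (coeff f a)) * (\<Sum>b\<in>monomials g. term_of b (coeff g b))"
    by (simp only: sum_terms)
  then show ?thesis
    by (simp add: sum_product mult_single)
qed

lemma monomials_mult:
  "m \<in> monomials (f * g) \<Longrightarrow> \<exists>a\<in>monomials f. \<exists>b\<in>monomials g. m = a + b"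
  using keys_mult by blast

lemma Var_power: "Var i ^ k = term_of (Poly_Mapping.single i k) 1"
  by (induction k) (simp_all add: Var_def mult_single flip: single_add)

lemma coeff_mult_term:
  fixes h :: "('n, 'a::comm_ring_1) mpoly"
  shows "coeff (h * term_of m c) (k + m) = coeff h k * c"
proof -
  have "coeff (h * term_of m c) (k + m)
      = (\<Sum>a\<in>monomials h. if a = k then (\<Sum>b\<in>monomials (term_of m c). if b = m then coeff h k * c else 0) else 0)"
    unfolding mult_eq_sum_terms lookup_sum
    by (intro sum.cong refl) (auto simp: lookup_single when_def)
  also have "\<dots> = coeff h k * c"
    by (auto simp: in_keys_iff)
  finally show ?thesis .
qed

lemma term_mult_eq_Var:
  fixes m :: "'n \<Rightarrow>\<^sub>0 nat" and c :: "'a::field"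
  assumes "k \<le> exponent m i"
  shows "term_of m c = term_of (m - Poly_Mapping.single i k) c * Var i ^ k"
proof -
  have "m - Poly_Mapping.single i k + Poly_Mapping.single i k = m"
    using assms by (intro poly_mapping_eqI) (auto simp: lookup_add lookup_minus lookup_single when_def)
  then show ?thesis
    by (simp add: Var_power mult_single)
qed

lemma CHAR_mpoly: "CHAR(('n, 'a::field) mpoly) = CHAR('a)"
proof (rule CHAR_eqI)
  show "of_nat CHAR('a) = (0 :: ('n, 'a) mpoly)"
  proof -
    have "term_of 0 (of_nat CHAR('a) :: 'a) = (of_nat CHAR('a) :: ('n, 'a) mpoly)"
      by (rule single_of_nat)
    then show ?thesis
      by (simp del: single_of_nat)
  qed
  fix k assume "of_nat k = (0 :: ('n, 'a) mpoly)"
  then have "(of_nat k :: 'a) = 0"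
    using arg_cong[where f = "\<lambda>h. coeff h 0", of "of_nat k" 0] by (simp add: lookup_of_nat)
  then show "CHAR('a) dvd k"
    by (simp add: of_nat_eq_0_iff_char_dvd)
qed

lemma term_power:
  fixes c :: "'a::field"
  shows "term_of m c ^ k = term_of (scale_expo k m) (c ^ k)"
proof (induction k)
  case 0
  have "scale_expo 0 m = 0"
    by (intro expo_eqI) simp
  then show ?case by simp
next
  case (Suc k)
  have "m + scale_expo k m = scale_expo (Suc k) m"
    by (intro expo_eqI) (simp add: lookup_add)
  then show ?case
    by (simp add: Suc mult_single)
qed

lemma frobenius_power_eq:
  fixes h :: "('n::finite, 'a::field) mpoly"
  assumes "prime CHAR('a)" "q = CHAR('a) ^ e"
  shows "h ^ q = (\<Sum>m\<in>monomials h. term_of (scale_expo q m) (coeff h m ^ q))"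
proof -
  have "h ^ q = (\<Sum>m\<in>monomials h. term_of m (coeff h m)) ^ q"
    by (simp only: sum_terms)
  also have "\<dots> = (\<Sum>m\<in>monomials h. term_of m (coeff h m) ^ q)"
    using assms by (intro freshmans_dream_sum'[where n = e]) (simp_all add: CHAR_mpoly)
  finally show ?thesis
    by (simp add: term_power)
qed

text \<open>The coefficients of \<open>g ^ q\<close> sit at the exponents divisible by \<open>q\<close>, so a product with \<open>g ^ q\<close> is
  as easy to expand as a product with \<open>g\<close>.\<close>

lemma coeff_frobenius_mult:
  fixes u g :: "('n::finite, 'a::field) mpoly"
  assumes "prime CHAR('a)" "q = CHAR('a) ^ e"
  shows "coeff (u * g ^ q) k =
    (\<Sum>a\<in>monomials u. \<Sum>m\<in>monomials g. coeff u a * coeff g m ^ q when a + scale_expo q m = k)"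
proof -
  have "u * g ^ q = (\<Sum>a\<in>monomials u. term_of a (coeff u a)) *
      (\<Sum>m\<in>monomials g. term_of (scale_expo q m) (coeff g m ^ q))"
    by (simp only: sum_terms frobenius_power_eq[OF assms])
  then show ?thesis
    by (simp add: sum_product mult_single lookup_sum lookup_single)
qed

section \<open>Ideals\<close>

lemma ideal_gen_mult: "x \<in> ideal_gen S \<Longrightarrow> r * x \<in> ideal_gen S"
  unfolding ideal_gen_def by (rule Modules.module.span_scale[OF module_self])

lemma ideal_gen_zero: "0 \<in> ideal_gen S"
  unfolding ideal_gen_def by (rule Modules.module.span_zero[OF module_self])

lemma ideal_gen_base: "x \<in> S \<Longrightarrow> x \<in> ideal_gen S"
  unfolding ideal_gen_def by (rule Modules.module.span_base[OF module_self])

lemma ideal_gen_sum: "(\<And>i. i \<in> A \<Longrightarrow> x i \<in> ideal_gen S) \<Longrightarrow> sum x A \<in> ideal_gen S"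
  unfolding ideal_gen_def by (rule Modules.module.span_sum[OF module_self])

text \<open>With finitely many indexed generators all coefficients can be taken over the whole index type,
  repetitions among the generators included.\<close>

lemma ideal_gen_range_iff:
  fixes g :: "'n::finite \<Rightarrow> 'r::comm_ring_1"
  shows "x \<in> ideal_gen (range g) \<longleftrightarrow> (\<exists>r. x = (\<Sum>i\<in>UNIV. r i * g i))"
proof
  assume x: "x \<in> ideal_gen (range g)"
  let ?C = "{x. \<exists>r. x = (\<Sum>i\<in>UNIV. r i * g i)}"
  have "ideal_gen (range g) \<subseteq> ?C"
    unfolding ideal_gen_def
  proof (rule Modules.module.span_minimal[OF module_self])
    show "range g \<subseteq> ?C"
    proof clarify
      fix i
      show "\<exists>r. g i = (\<Sum>j\<in>UNIV. r j * g j)"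
        by (rule exI[of _ "\<lambda>j. if j = i then 1 else 0"]) (simp add: if_distrib[of "\<lambda>x. x * _"] cong: if_cong)
    qed
    show "Modules.module.subspace (*) ?C"
      unfolding Modules.module.subspace_def[OF module_self]
    proof (intro conjI ballI allI)
      show "0 \<in> ?C"
        by (auto intro!: exI[of _ "\<lambda>_. 0"])
    next
      fix x y assume "x \<in> ?C" "y \<in> ?C"
      then obtain r s where "x = (\<Sum>i\<in>UNIV. r i * g i)" "y = (\<Sum>i\<in>UNIV. s i * g i)"
        by blast
      then show "x + y \<in> ?C"
        by (auto intro!: exI[of _ "\<lambda>i. r i + s i"] simp: sum.distrib distrib_right)
    next
      fix c x assume "x \<in> ?C"
      then obtain r where "x = (\<Sum>i\<in>UNIV. r i * g i)"
        by blast
      then show "c * x \<in> ?C"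
        by (auto intro!: exI[of _ "\<lambda>i. c * r i"] simp: sum_distrib_left mult.assoc)
    qed
  qed
  then show "\<exists>r. x = (\<Sum>i\<in>UNIV. r i * g i)"
    using x by blast
next
  assume "\<exists>r. x = (\<Sum>i\<in>UNIV. r i * g i)"
  then obtain r where x: "x = (\<Sum>i\<in>UNIV. r i * g i)" ..
  show "x \<in> ideal_gen (range g)"
    unfolding x by (intro ideal_gen_sum ideal_gen_mult ideal_gen_base rangeI)
qed

text \<open>A monomial ideal: membership is decided monomial by monomial.\<close>

lemma mem_frobenius_ideal_iff:
  fixes h :: "('n::finite, 'a::field) mpoly"
  shows "h \<in> frobenius_ideal q \<longleftrightarrow> (\<forall>m\<in>monomials h. \<exists>i. q \<le> exponent m i)"
proof
  assume "h \<in> frobenius_ideal q"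
  then obtain r where h: "h = (\<Sum>i\<in>UNIV. r i * Var i ^ q)"
    unfolding frobenius_ideal_def ideal_gen_range_iff by blast
  show "\<forall>m\<in>monomials h. \<exists>i. q \<le> exponent m i"
  proof
    fix m assume "m \<in> monomials h"
    then obtain i where "m \<in> monomials (r i * Var i ^ q)"
      unfolding h using keys_sum by (metis (no_types, lifting) UN_E in_mono)
    then obtain a where "m = a + Poly_Mapping.single i q"
      by (auto simp: Var_power dest!: monomials_mult)
    then have "q \<le> exponent m i"
      by (simp add: lookup_add)
    then show "\<exists>i. q \<le> exponent m i" ..
  qed
next
  assume *: "\<forall>m\<in>monomials h. \<exists>i. q \<le> exponent m i"
  have "(\<Sum>m\<in>monomials h. term_of m (coeff h m)) \<in> frobenius_ideal q"
    unfolding frobenius_ideal_def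
  proof (rule ideal_gen_sum)
    fix m assume "m \<in> monomials h"
    with * obtain i where "q \<le> exponent m i" by blast
    then have "term_of m (coeff h m) = term_of (m - Poly_Mapping.single i q) (coeff h m) * Var i ^ q"
      by (rule term_mult_eq_Var)
    then show "term_of m (coeff h m) \<in> ideal_gen (range (\<lambda>i. Var i ^ q))"
      by (simp add: ideal_gen_base ideal_gen_mult)
  qed
  then show "h \<in> frobenius_ideal q"
    by (simp only: sum_terms)
qed

lemma max_ideal_eq_frobenius_ideal: "max_ideal = frobenius_ideal 1"
  by (simp add: max_ideal_def frobenius_ideal_def)

text \<open>If every exponent of \<open>b\<close> is below \<open>q\<close>, then \<open>b + q * c = a + q * m\<close> can only hold with
  \<open>m \<le> c\<close>. Choosing \<open>b\<close> from \<open>u\<close> and \<open>c\<close> of minimal size from \<open>g\<close> therefore leaves no room for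
  cancellation at \<open>b + q * c\<close>. This is the source of the superadditivity of \<open>nu\<close>.\<close>

lemma frobenius_mult_notin:
  fixes u g :: "('n::finite, 'a::field) mpoly"
  assumes "prime CHAR('a)" "q = CHAR('a) ^ e"
    and u: "u \<notin> frobenius_ideal q" and g: "g \<notin> frobenius_ideal Q"
  shows "u * g ^ q \<notin> frobenius_ideal (q * Q)"
proof -
  from u obtain b where b: "b \<in> monomials u" "\<And>i. exponent b i < q"
    by (auto simp: mem_frobenius_ideal_iff not_le)
  define S where "S = {m \<in> monomials g. \<forall>i. exponent m i < Q}"
  define size where "size m = (\<Sum>i\<in>UNIV. exponent m i)" for m :: "'n \<Rightarrow>\<^sub>0 nat"
  have "S \<noteq> {}"
    using g by (auto simp: mem_frobenius_ideal_iff not_le S_def)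
  then obtain c where c: "c \<in> S" "\<And>m. m \<in> S \<Longrightarrow> size c \<le> size m"
    using ex_has_least_nat[of "\<lambda>m. m \<in> S" _ size] by blast
  \<comment> \<open>a second pair of monomials with the same sum would have a smaller second component\<close>
  have only: "a = b \<and> m = c" if m: "m \<in> monomials g" and eq: "a + scale_expo q m = b + scale_expo q c" for a m
  proof -
    have le: "exponent m i \<le> exponent c i" for i
    proof -
      have "exponent a i + q * exponent m i = exponent b i + q * exponent c i"
        using arg_cong[OF eq, of "\<lambda>m. exponent m i"] by (simp add: lookup_add)
      then have "q * exponent m i < q * (exponent c i + 1)"
        using b(2)[of i] by simp
      then have "exponent m i < exponent c i + 1"
        by (simp only: mult_less_cancel1)
      then show ?thesis
        by simp
    qed
    then have "m \<in> S"
      using c(1) m by (auto simp: S_def intro: le_less_trans)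
    then have "size c \<le> size m" by (rule c(2))
    then have "exponent m i = exponent c i" for i
      using le sum_strict_mono_ex1[of UNIV "exponent m" "exponent c"]
      unfolding size_def by (metis finite_class.finite_UNIV UNIV_I le_antisym linorder_not_le nless_le)
    then have "m = c" by (rule expo_eqI)
    then show ?thesis using eq by simp
  qed
  then have iff: "a + scale_expo q m = b + scale_expo q c \<longleftrightarrow> a = b \<and> m = c"
    if "m \<in> monomials g" for a m
    using that by blast
  have "coeff (u * g ^ q) (b + scale_expo q c) =
    (\<Sum>a\<in>monomials u. if a = b then (\<Sum>m\<in>monomials g. if m = c then coeff u b * coeff g c ^ q else 0) else 0)"
    unfolding coeff_frobenius_mult[OF assms(1,2)]
  proof (intro sum.cong refl)
    fix a
    show "(\<Sum>m\<in>monomials g. coeff u a * coeff g m ^ q when a + scale_expo q m = b + scale_expo q c) =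
      (if a = b then (\<Sum>m\<in>monomials g. if m = c then coeff u b * coeff g c ^ q else 0) else 0)"
      by (cases "a = b") (auto simp: when_def iff simp del: add_left_cancel intro!: sum.cong)
  qed
  also have "\<dots> = coeff u b * coeff g c ^ q"
    using b(1) c(1) by (simp add: S_def)
  also have "\<dots> \<noteq> 0"
    using b(1) c(1) by (simp add: S_def in_keys_iff)
  finally have mem: "b + scale_expo q c \<in> monomials (u * g ^ q)"
    by (simp add: in_keys_iff)
  have "exponent (b + scale_expo q c) i < q * Q" for i
  proof -
    have "exponent c i + 1 \<le> Q" using c(1) by (simp add: S_def Suc_le_eq)
    then have "q * (exponent c i + 1) \<le> q * Q" by (rule mult_le_mono2)
    then show ?thesis using b(2)[of i] by (simp add: lookup_add)
  qed
  then show ?thesis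
    using mem by (meson linorder_not_le mem_frobenius_ideal_iff)
qed

lemma frobenius_ideal_power:
  fixes g :: "('n::finite, 'a::field) mpoly"
  assumes "prime CHAR('a)" "q = CHAR('a) ^ e" and g: "g \<in> frobenius_ideal Q"
  shows "g ^ q \<in> frobenius_ideal (q * Q)"
proof -
  have "\<exists>i. q * Q \<le> exponent m i" if "m \<in> monomials (g ^ q)" for m
  proof -
    have "monomials (g ^ q) \<subseteq> (\<Union>k\<in>monomials g. monomials (term_of (scale_expo q k) (coeff g k ^ q)))"
      unfolding frobenius_power_eq[OF assms(1,2)] by (rule keys_sum)
    then have "m \<in> (\<Union>k\<in>monomials g. monomials (term_of (scale_expo q k) (coeff g k ^ q)))"
      using that by blast
    then obtain k where k: "k \<in> monomials g" "m = scale_expo q k"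
      by (auto split: if_splits)
    then obtain i where "Q \<le> exponent k i"
      using g by (auto simp: mem_frobenius_ideal_iff)
    then show ?thesis
      using k by (auto intro!: exI[of _ i])
  qed
  then show ?thesis
    by (simp add: mem_frobenius_ideal_iff)
qed

section \<open>Weighted forms\<close>

definition wt :: "('n::finite \<Rightarrow> nat) \<Rightarrow> ('n \<Rightarrow>\<^sub>0 nat) \<Rightarrow> nat" where
  "wt w m = (\<Sum>i\<in>UNIV. w i * exponent m i)"

definition form :: "('n::finite \<Rightarrow> nat) \<Rightarrow> nat \<Rightarrow> ('n, 'a::zero) mpoly \<Rightarrow> bool" where
  "form w D h \<longleftrightarrow> (\<forall>m\<in>monomials h. wt w m = D)"

definition part :: "(('n \<Rightarrow>\<^sub>0 nat) \<Rightarrow> bool) \<Rightarrow> ('n, 'a::comm_monoid_add) mpoly \<Rightarrow> ('n, 'a) mpoly" where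
  "part P h = (\<Sum>m\<in>{m \<in> monomials h. P m}. term_of m (coeff h m))"

lemma wt_add: "wt w (a + b) = wt w a + wt w b"
  by (simp add: wt_def lookup_add distrib_left sum.distrib)

lemma wt_scale: "wt w (scale_expo q m) = q * wt w m"
  by (simp add: wt_def sum_distrib_left mult.left_commute)

lemma wt_single: "wt w (Poly_Mapping.single i k) = w i * k"
proof -
  have "wt w (Poly_Mapping.single i k) = (\<Sum>j\<in>UNIV. if j = i then w i * k else 0)"
    unfolding wt_def by (intro sum.cong) (auto simp: lookup_single when_def)
  then show ?thesis by simp
qed

lemma wt_const: "wt w (expo (\<lambda>_. c)) = c * (\<Sum>i\<in>UNIV. w i)"
  by (simp add: wt_def sum_distrib_left mult.commute)

lemma form_mult: "form w D h \<Longrightarrow> form w E k \<Longrightarrow> form w (D + E) (h * k)"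
  unfolding form_def by (metis monomials_mult wt_add)

lemma form_one: "form w 0 1"
  by (simp add: form_def wt_def)

lemma form_power: "form w D h \<Longrightarrow> form w (k * D) (h ^ k)"
  by (induction k) (auto simp: form_one intro: form_mult)

lemma coeff_part: "coeff (part P h) k = (coeff h k when P k)"
proof -
  have "coeff (part P h) k = (\<Sum>m\<in>{m \<in> monomials h. P m}. if m = k then coeff h k else 0)"
    unfolding part_def lookup_sum by (intro sum.cong refl) (auto simp: lookup_single when_def)
  also have "\<dots> = (coeff h k when P k)"
    by (auto simp: in_keys_iff when_def)
  finally show ?thesis .
qed

lemma part_add: "part P (g + h) = part P g + part P h"
  by (rule poly_mapping_eqI) (simp add: coeff_part lookup_add when_add_distrib)

lemma part_sum: "part P (\<Sum>i\<in>A. h i) = (\<Sum>i\<in>A. part P (h i))"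
  by (rule poly_mapping_eqI) (simp add: coeff_part lookup_sum when_def)

lemma part_id: "(\<And>m. m \<in> monomials h \<Longrightarrow> P m) \<Longrightarrow> part P h = h"
  by (rule poly_mapping_eqI) (auto simp: coeff_part when_def in_keys_iff)

lemma part_none: "(\<And>m. m \<in> monomials h \<Longrightarrow> \<not> P m) \<Longrightarrow> part P h = 0"
  by (rule poly_mapping_eqI) (auto simp: coeff_part when_def in_keys_iff)

lemma monomials_part: "m \<in> monomials (part P h) \<longleftrightarrow> m \<in> monomials h \<and> P m"
  by (auto simp: in_keys_iff coeff_part when_def)

text \<open>Multiplication by a form is graded, so it commutes with taking graded pieces after a shift of
  the degree.\<close>

lemma part_mult_form:
  fixes r g :: "('n::finite, 'a::field) mpoly"
  assumes "form w e g"
  shows "part (\<lambda>m. wt w m = D) (r * g) = part (\<lambda>m. wt w m + e = D) r * g"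
proof -
  let ?P = "\<lambda>m. wt w m = D" and ?Q = "\<lambda>m. wt w m + e = D"
  have split: "r = part ?Q r + part (\<lambda>m. \<not> ?Q m) r"
    by (rule poly_mapping_eqI) (simp add: coeff_part lookup_add when_def)
  have wt_prod: "\<exists>a\<in>monomials s. wt w m = wt w a + e" if "m \<in> monomials (s * g)" for m s
    using monomials_mult[OF that] assms by (auto simp: form_def wt_add)
  have "part ?P (part ?Q r * g) = part ?Q r * g"
  proof (rule part_id)
    fix m assume "m \<in> monomials (part ?Q r * g)"
    from wt_prod[OF this] show "wt w m = D" by (auto simp: monomials_part)
  qed
  moreover have "part ?P (part (\<lambda>m. \<not> ?Q m) r * g) = 0"
  proof (rule part_none)
    fix m assume "m \<in> monomials (part (\<lambda>m. \<not> ?Q m) r * g)"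
    from wt_prod[OF this] show "wt w m \<noteq> D" by (auto simp: monomials_part)
  qed
  ultimately show ?thesis
    by (subst split) (simp add: distrib_right part_add)
qed

text \<open>The coefficients that express a form through forms may be taken homogeneous. The degree condition is
  additive, so that it forces \<open>s i = 0\<close> when \<open>e i > D\<close>.\<close>

lemma form_in_ideal_coefficients:
  fixes g :: "'n::finite \<Rightarrow> ('n, 'a::field) mpoly"
  assumes "form w D h" and g: "\<And>i. form w (e i) (g i)" and "h \<in> ideal_gen (range g)"
  shows "\<exists>s. h = (\<Sum>i\<in>UNIV. s i * g i) \<and> (\<forall>i. \<forall>m\<in>monomials (s i). wt w m + e i = D)"
proof -
  obtain r where r: "h = (\<Sum>i\<in>UNIV. r i * g i)"
    using assms(3) unfolding ideal_gen_range_iff by blast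
  have "h = part (\<lambda>m. wt w m = D) h"
    using assms(1) by (intro part_id[symmetric]) (auto simp: form_def)
  also have "\<dots> = (\<Sum>i\<in>UNIV. part (\<lambda>m. wt w m + e i = D) (r i) * g i)"
    by (simp add: r part_sum part_mult_form[OF g])
  finally show ?thesis
    by (intro exI[of _ "\<lambda>i. part (\<lambda>m. wt w m + e i = D) (r i)"]) (simp add: monomials_part)
qed

section \<open>Splitting the Frobenius endomorphism\<close>

text \<open>Let the field act on itself through \<open>q\<close>-th powers. The vector \<open>1\<close> is independent for this
  structure and so extends to a basis, which gives a linear functional with value \<open>1\<close> there. For a perfect field
  \<open>\<pi>\<close> is simply the \<open>q\<close>-th root.\<close>

lemma frobenius_splitting:
  assumes "prime CHAR('a::field)" "q = CHAR('a::field) ^ e"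
  obtains \<pi> :: "'a::field \<Rightarrow> 'a" where "\<pi> 1 = 1" "\<And>x y. \<pi> (x + y) = \<pi> x + \<pi> y"
    "\<And>c x. \<pi> (c ^ q * x) = c * \<pi> x"
proof -
  have q: "q > 0"
    using assms by (simp add: prime_gt_0_nat)
  have vs: "vector_space (\<lambda>(c::'a) x::'a. c ^ q * x)"
    by unfold_locales
      (simp_all add: algebra_simps power_mult_distrib freshmans_dream'[OF assms])
  have vs': "vector_space ((*) :: 'a \<Rightarrow> 'a \<Rightarrow> 'a)"
    by unfold_locales (simp_all add: algebra_simps)
  interpret vector_space_pair "\<lambda>(c::'a) x::'a. c ^ q * x" "(*) :: 'a \<Rightarrow> 'a \<Rightarrow> 'a"
    by (rule vector_space_pair.intro[OF vs vs'])
  have "vs1.independent {1}"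
    using vs1.dependent_single[of 1] by simp
  from linear_independent_extend[OF this, of "\<lambda>_. 1"]
  obtain \<pi> :: "'a \<Rightarrow> 'a" where "Vector_Spaces.linear (\<lambda>c x. c ^ q * x) (*) \<pi>" "\<pi> 1 = 1"
    by auto
  then show ?thesis
    using that linear_add linear_scale by blast
qed

text \<open>Expand \<open>h = \<Sum>\<beta>. x ^ \<beta> * h\<^sub>\<beta>(x ^ q)\<close> over the exponents \<open>\<beta>\<close> with entries below \<open>q\<close>. The trace
  extracts the component at \<open>\<beta> = (q - 1, \<dots>, q - 1)\<close> and takes a \<open>q\<close>-th root of it, through \<open>\<pi>\<close> on the
  coefficients. Being linear over \<open>q\<close>-th powers (lemma \<open>frobenius_trace_linear\<close>), it maps
  \<open>(g\<^sub>1 ^ q, \<dots>, g\<^sub>n ^ q)\<close> into \<open>(g\<^sub>1, \<dots>, g\<^sub>n)\<close>.\<close>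

definition frobenius_trace ::
    "('a::field \<Rightarrow> 'a) \<Rightarrow> nat \<Rightarrow> ('n::finite, 'a) mpoly \<Rightarrow> ('n, 'a) mpoly" where
  "frobenius_trace \<pi> q h = (\<Sum>m\<in>monomials h.
     term_of (expo (\<lambda>i. exponent m i div q)) (\<pi> (coeff h m)) when (\<forall>i. exponent m i mod q = q - 1))"

lemma frobenius_trace_add:
  assumes "\<And>x y. \<pi> (x + y) = \<pi> x + \<pi> y"
  shows "frobenius_trace \<pi> q (g + h) = frobenius_trace \<pi> q g + frobenius_trace \<pi> q h"
proof -
  have "\<pi> 0 = 0" using assms[of 0 0] by (metis add.right_neutral add_left_cancel)
  then show ?thesis
    unfolding frobenius_trace_def
    by (intro setsum_keys_plus_distrib) (simp_all add: assms single_add when_add_distrib)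
qed

lemma frobenius_trace_term:
  assumes "\<And>x y. \<pi> (x + y) = \<pi> x + \<pi> y"
  shows "frobenius_trace \<pi> q (term_of m c) =
    (term_of (expo (\<lambda>i. exponent m i div q)) (\<pi> c) when (\<forall>i. exponent m i mod q = q - 1))"
proof -
  have "\<pi> 0 = 0" using assms[of 0 0] by (metis add.right_neutral add_left_cancel)
  then show ?thesis
    by (cases "c = 0") (simp_all add: frobenius_trace_def)
qed

lemma frobenius_trace_sum:
  assumes "\<And>x y. \<pi> (x + y) = \<pi> x + \<pi> y"
  shows "frobenius_trace \<pi> q (sum h A) = (\<Sum>i\<in>A. frobenius_trace \<pi> q (h i))"
proof (induction A rule: infinite_finite_induct)
  case (insert x F)
  then show ?case by (simp add: frobenius_trace_add[OF assms])
qed (simp_all add: frobenius_trace_def)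

lemma frobenius_trace_linear:
  fixes r h :: "('n::finite, 'a::field) mpoly"
  assumes "prime CHAR('a)" "q = CHAR('a) ^ e"
    and add: "\<And>x y. \<pi> (x + y) = \<pi> x + \<pi> y"
    and scale: "\<And>c x. \<pi> (c ^ q * x) = c * \<pi> x"
  shows "frobenius_trace \<pi> q (r * h ^ q) = frobenius_trace \<pi> q r * h"
proof -
  have q: "q > 0"
    using assms(1,2) by (simp add: prime_gt_0_nat)
  let ?T = "frobenius_trace \<pi> q"
  have trace_term: "?T (term_of (a + scale_expo q m) (c * d ^ q)) = ?T (term_of a c) * term_of m d"
    for a m :: "'n \<Rightarrow>\<^sub>0 nat" and c d
  proof -
    have "expo (\<lambda>i. (exponent a i + q * exponent m i) div q) = expo (\<lambda>i. exponent a i div q) + m"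
      by (rule expo_eqI) (use q in \<open>simp add: lookup_add\<close>)
    moreover have "\<pi> (c * d ^ q) = \<pi> c * d"
      by (metis mult.commute scale)
    ultimately show ?thesis
      by (simp add: frobenius_trace_term[OF add] lookup_add mult_single when_mult)
  qed
  have "r * h ^ q = (\<Sum>a\<in>monomials r. term_of a (coeff r a)) *
      (\<Sum>m\<in>monomials h. term_of (scale_expo q m) (coeff h m ^ q))"
    by (simp only: sum_terms frobenius_power_eq[OF assms(1,2)])
  then have "r * h ^ q = (\<Sum>a\<in>monomials r. \<Sum>m\<in>monomials h.
      term_of (a + scale_expo q m) (coeff r a * coeff h m ^ q))"
    by (simp add: sum_product mult_single)
  then have "?T (r * h ^ q) = (\<Sum>a\<in>monomials r. \<Sum>m\<in>monomials h.
      ?T (term_of a (coeff r a)) * term_of m (coeff h m))"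
    by (simp add: frobenius_trace_sum[OF add] trace_term)
  also have "\<dots> = ?T (\<Sum>a\<in>monomials r. term_of a (coeff r a)) * (\<Sum>m\<in>monomials h. term_of m (coeff h m))"
    by (simp add: sum_product frobenius_trace_sum[OF add])
  finally show ?thesis
    by (simp only: sum_terms)
qed

text \<open>The trace of \<open>x ^ (q * m + (q - 1))\<close> is \<open>x ^ m\<close>.\<close>

lemma monomial_in_ideal_if_scaled_in_frobenius_power:
  fixes g :: "'n::finite \<Rightarrow> ('n, 'a::field) mpoly"
  assumes "prime CHAR('a)" "q = CHAR('a) ^ e"
    and mem: "term_of (scale_expo q m + expo (\<lambda>_. q - 1)) 1 \<in> ideal_gen (range (\<lambda>i. g i ^ q))"
  shows "term_of m 1 \<in> ideal_gen (range g)"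
proof -
  have q: "q > 0"
    using assms(1,2) by (simp add: prime_gt_0_nat)
  obtain \<pi> :: "'a \<Rightarrow> 'a" where \<pi>: "\<pi> 1 = 1" "\<And>x y. \<pi> (x + y) = \<pi> x + \<pi> y"
      "\<And>c x. \<pi> (c ^ q * x) = c * \<pi> x"
    using frobenius_splitting[OF assms(1,2)] by metis
  obtain r where r: "term_of (scale_expo q m + expo (\<lambda>_. q - 1)) 1 = (\<Sum>i\<in>UNIV. r i * g i ^ q)"
    using mem unfolding ideal_gen_range_iff by blast
  have div: "(q * x + q - Suc 0) div q = x" for x
    by (rule div_nat_eqI) (use q in simp_all)
  have mod: "(q * x + q - Suc 0) mod q = q - Suc 0" for x
    using q mod_mult_self4[of q x "q - Suc 0"] by (simp add: Nat.add_diff_assoc)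
  have "expo (exponent m) = m"
    by (rule expo_eqI) simp
  then have "term_of m 1 = frobenius_trace \<pi> q (term_of (scale_expo q m + expo (\<lambda>_. q - 1)) 1)"
    using q by (simp add: frobenius_trace_term[OF \<pi>(2)] \<pi>(1) lookup_add div mod)
  also have "\<dots> = (\<Sum>i\<in>UNIV. frobenius_trace \<pi> q (r i) * g i)"
    by (simp only: r frobenius_trace_sum[OF \<pi>(2)] frobenius_trace_linear[OF assms(1,2) \<pi>(2,3)])
  finally show ?thesis
    unfolding ideal_gen_range_iff by (intro exI[of _ "\<lambda>i. frobenius_trace \<pi> q (r i)"])
qed

section \<open>The top degree of a graded complete intersection\<close>

text \<open>A monomial of such weight must have some exponent at least \<open>k i\<close>.\<close>

lemma large_forms_in_ideal:
  fixes g :: "'n::finite \<Rightarrow> ('n, 'a::field) mpoly"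
  assumes powers: "\<And>i. Var i ^ k i \<in> ideal_gen (range g)"
    and "form w D h" and D: "D > (\<Sum>i\<in>UNIV. w i * k i)"
  shows "h \<in> ideal_gen (range g)"
proof -
  have "(\<Sum>m\<in>monomials h. term_of m (coeff h m)) \<in> ideal_gen (range g)"
  proof (rule ideal_gen_sum)
    fix m assume "m \<in> monomials h"
    then have "(\<Sum>i\<in>UNIV. w i * k i) < (\<Sum>i\<in>UNIV. w i * exponent m i)"
      using assms(2) D by (simp add: form_def wt_def)
    then obtain i where "\<not> w i * exponent m i \<le> w i * k i"
      by (metis (mono_tags, lifting) linorder_not_le sum_mono)
    then have "k i \<le> exponent m i"
      by (meson mult_le_mono2 nle_le)
    then have "term_of m (coeff h m) = term_of (m - Poly_Mapping.single i (k i)) (coeff h m) * Var i ^ k i"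
      by (rule term_mult_eq_Var)
    then show "term_of m (coeff h m) \<in> ideal_gen (range g)"
      using powers by (simp add: ideal_gen_mult)
  qed
  then show ?thesis by (simp only: sum_terms)
qed

text \<open>A cofactor \<open>r\<close> of weight above \<open>M\<close> lies in the ideal and can be traded for one more factor \<open>g i\<close>
  without changing the total weight. When this stops, the weight has moved into the exponents
  \<open>\<alpha>\<close>, and some \<open>\<alpha> i\<close> has reached \<open>q\<close>.\<close>

lemma large_forms_in_frobenius_power:
  fixes g :: "'n::finite \<Rightarrow> ('n, 'a::field) mpoly"
  assumes g: "\<And>i. form w (e i) (g i)" and e: "\<And>i. e i > 0"
    and large: "\<And>D h. form w D h \<Longrightarrow> D > M \<Longrightarrow> h \<in> ideal_gen (range g)"
    and "form w U r" "U + (\<Sum>i\<in>UNIV. \<alpha> i * e i) > M + (q - 1) * (\<Sum>i\<in>UNIV. e i)"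
  shows "r * (\<Prod>i\<in>UNIV. g i ^ \<alpha> i) \<in> ideal_gen (range (\<lambda>i. g i ^ q))"
  using assms(4,5)
proof (induction U arbitrary: r \<alpha> rule: less_induct)
  case (less U)
  let ?J = "ideal_gen (range (\<lambda>i. g i ^ q))"
  show ?case
  proof (cases "\<exists>i. q \<le> \<alpha> i")
    case True
    then obtain i where "q \<le> \<alpha> i" ..
    then have "g i ^ \<alpha> i = g i ^ (\<alpha> i - q) * g i ^ q"
      by (simp flip: power_add)
    then have "r * (\<Prod>i\<in>UNIV. g i ^ \<alpha> i) =
        (r * (\<Prod>j\<in>UNIV - {i}. g j ^ \<alpha> j) * g i ^ (\<alpha> i - q)) * g i ^ q"
      by (simp add: prod.remove[of UNIV i] mult_ac)
    then show ?thesis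
      by (simp add: ideal_gen_mult ideal_gen_base)
  next
    case False
    then have "\<alpha> i \<le> q - 1" for i
      by (metis One_nat_def Suc_pred le_less_linear less_Suc_eq_le not_less_zero neq0_conv le0)
    then have "(\<Sum>i\<in>UNIV. \<alpha> i * e i) \<le> (q - 1) * (\<Sum>i\<in>UNIV. e i)"
      by (simp add: sum_distrib_left sum_mono)
    then have U: "U > M"
      using less.prems(2) by linarith
    then have "r \<in> ideal_gen (range g)"
      using large less.prems(1) by blast
    from form_in_ideal_coefficients[OF less.prems(1) g this]
    obtain s where s: "r = (\<Sum>i\<in>UNIV. s i * g i)" "\<And>i m. m \<in> monomials (s i) \<Longrightarrow> wt w m + e i = U"
      by blast
    have "s i * g i * (\<Prod>j\<in>UNIV. g j ^ \<alpha> j) \<in> ?J" for i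
    proof (cases "s i = 0")
      case True
      then show ?thesis by (simp add: ideal_gen_zero)
    next
      case False
      then obtain m where "m \<in> monomials (s i)"
        by fastforce
      then have U': "U - e i + e i = U"
        using s(2) by fastforce
      define \<beta> where "\<beta> = \<alpha>(i := \<alpha> i + 1)"
      have "(\<Sum>j\<in>UNIV. \<beta> j * e j) = (\<Sum>j\<in>UNIV. \<alpha> j * e j) + e i"
        by (simp add: \<beta>_def sum.remove[of UNIV i])
      moreover have "(\<Prod>j\<in>UNIV. g j ^ \<beta> j) = g i * (\<Prod>j\<in>UNIV. g j ^ \<alpha> j)"
        by (simp add: \<beta>_def prod.remove[of UNIV i] mult_ac)
      moreover have "s i * (\<Prod>j\<in>UNIV. g j ^ \<beta> j) \<in> ?J"
      proof (rule less.IH)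
        show "U - e i < U" using U e[of i] by simp
        show "form w (U - e i) (s i)"
          unfolding form_def using s(2) by fastforce
        show "U - e i + (\<Sum>j\<in>UNIV. \<beta> j * e j) > M + (q - 1) * (\<Sum>j\<in>UNIV. e j)"
          using less.prems(2) U' calculation(1) by linarith
      qed
      ultimately show ?thesis
        by (simp add: mult.assoc)
    qed
    then have "(\<Sum>i\<in>UNIV. s i * g i * (\<Prod>j\<in>UNIV. g j ^ \<alpha> j)) \<in> ?J"
      by (intro ideal_gen_sum)
    then show ?thesis
      by (simp add: s(1) sum_distrib_right)
  qed
qed

text \<open>The generators form a system of parameters, and \<open>\<Sum>i. e i - \<Sum>i. w i\<close> is the socle degree of the
  quotient by them. If \<open>x ^ m\<close> had larger weight, then \<open>x ^ (q * m + (q - 1))\<close> would outweigh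
  \<open>M + (q - 1) * \<Sum>i. e i\<close> once \<open>q > M + 1\<close>.\<close>

lemma complete_intersection_top_degree:
  fixes g :: "'n::finite \<Rightarrow> ('n, 'a::field) mpoly"
  assumes "prime CHAR('a)"
    and g: "\<And>i. form w (e i) (g i)" and e: "\<And>i. e i > 0"
    and powers: "\<And>i. Var i ^ k i \<in> ideal_gen (range g)"
    and m: "term_of m 1 \<notin> ideal_gen (range g)"
  shows "wt w m + (\<Sum>i\<in>UNIV. w i) \<le> (\<Sum>i\<in>UNIV. e i)"
proof (rule ccontr)
  define M where "M = (\<Sum>i\<in>UNIV. w i * k i)"
  \<comment> \<open>the exponent only has to make \<open>q > M + 1\<close>\<close>
  define q where "q = CHAR('a) ^ (M + 1)"
  define x where "x = term_of (scale_expo q m + expo (\<lambda>_. q - 1)) (1 :: 'a)"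
  let ?\<sigma> = "\<Sum>i\<in>UNIV. w i" and ?e = "\<Sum>i\<in>UNIV. e i"
  assume "\<not> wt w m + ?\<sigma> \<le> ?e"
  then have "(q - 1) * (?e + 1) \<le> (q - 1) * (wt w m + ?\<sigma>)"
    by (intro mult_le_mono2) simp
  moreover have "q > M + 1"
    unfolding q_def using power_gt_expt[of "CHAR('a)" "M + 1"] prime_gt_1_nat[OF assms(1)] by simp
  ultimately have "M + (q - 1) * ?e < q * wt w m + (q - 1) * ?\<sigma>"
    by (cases q) (simp_all add: algebra_simps)
  then have "M + (q - 1) * ?e < wt w (scale_expo q m + expo (\<lambda>_. q - 1)) + (\<Sum>i\<in>UNIV. 0 * e i)"
    by (simp only: wt_add wt_scale wt_const mult_0 sum.neutral_const add_0_right)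
  then have "x * (\<Prod>i\<in>UNIV. g i ^ 0) \<in> ideal_gen (range (\<lambda>i. g i ^ q))"
    using large_forms_in_ideal[of k g w, folded M_def, OF powers]
    by (intro large_forms_in_frobenius_power[where \<alpha> = "\<lambda>_. 0" and M = M, OF g e])
      (simp_all add: form_def x_def)
  then have "term_of m (1 :: 'a) \<in> ideal_gen (range g)"
    using monomial_in_ideal_if_scaled_in_frobenius_power[OF assms(1) q_def] by (simp add: x_def)
  then show False using m by simp
qed

section \<open>Partial derivatives\<close>

lemma partial_deriv_term:
  "partial_deriv i (term_of m c) = term_of (m - Poly_Mapping.single i 1) (of_nat (exponent m i) * c)"
  by (cases "c = 0") (simp_all add: partial_deriv_def)

lemma partial_deriv_add: "partial_deriv i (f + g) = partial_deriv i f + partial_deriv i g"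
  unfolding partial_deriv_def
  by (intro setsum_keys_plus_distrib) (simp_all add: distrib_left single_add)

lemma partial_deriv_sum: "partial_deriv i (sum f A) = (\<Sum>x\<in>A. partial_deriv i (f x))"
proof (induction A rule: infinite_finite_induct)
  case (insert x F)
  then show ?case by (simp add: partial_deriv_add)
qed (simp_all add: partial_deriv_def)

lemma partial_deriv_term_mult:
  "partial_deriv i (term_of (a + b) (x * y)) =
    term_of a x * partial_deriv i (term_of b y) + partial_deriv i (term_of a x) * term_of b y"
proof -
  let ?v = "Poly_Mapping.single i (Suc 0)"
  have shift: "(a + b) - ?v = a + (b - ?v)" if "exponent b i > 0" for a b
    using that by (intro poly_mapping_eqI) (auto simp: lookup_add lookup_minus lookup_single when_def)
  have "term_of (a + b - ?v) (of_nat (exponent b i) * (x * y)) = term_of a x * partial_deriv i (term_of b y)"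
    by (cases "exponent b i = 0") (simp_all add: partial_deriv_term mult_single shift mult_ac)
  moreover have "term_of (a + b - ?v) (of_nat (exponent a i) * (x * y)) = partial_deriv i (term_of a x) * term_of b y"
    using shift[of a b] by (cases "exponent a i = 0") (simp_all add: partial_deriv_term mult_single add.commute[of _ b] mult_ac)
  ultimately show ?thesis
    by (simp add: partial_deriv_term lookup_add distrib_right single_add)
qed

lemma partial_deriv_mult:
  fixes f g :: "('n, 'a::field) mpoly"
  shows "partial_deriv i (f * g) = f * partial_deriv i g + partial_deriv i f * g"
proof -
  let ?t = "\<lambda>h m. term_of m (coeff h m)"
  have "partial_deriv i (f * g) =
      (\<Sum>a\<in>monomials f. \<Sum>b\<in>monomials g. ?t f a * partial_deriv i (?t g b) + partial_deriv i (?t f a) * ?t g b)"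
    by (simp only: mult_eq_sum_terms partial_deriv_sum partial_deriv_term_mult)
  also have "\<dots> = (\<Sum>a\<in>monomials f. ?t f a) * partial_deriv i (\<Sum>b\<in>monomials g. ?t g b)
      + partial_deriv i (\<Sum>a\<in>monomials f. ?t f a) * (\<Sum>b\<in>monomials g. ?t g b)"
    by (simp add: sum.distrib sum_product partial_deriv_sum)
  finally show ?thesis
    by (simp only: sum_terms)
qed

lemma partial_deriv_power:
  fixes f :: "('n, 'a::field) mpoly"
  shows "partial_deriv i (f ^ Suc N) = of_nat (Suc N) * (f ^ N * partial_deriv i f)"
proof (induction N)
  case (Suc N)
  have "partial_deriv i (f ^ Suc (Suc N)) = f * partial_deriv i (f ^ Suc N) + partial_deriv i f * f ^ Suc N"
    by (simp only: power_Suc[of f "Suc N"] partial_deriv_mult)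
  also have "\<dots> = of_nat (Suc (Suc N)) * (f ^ Suc N * partial_deriv i f)"
    unfolding Suc by (simp add: algebra_simps)
  finally show ?case .
qed simp

text \<open>The only exponent that could drop below \<open>q\<close> is one equal to \<open>q\<close>, and then the derivative carries the
  factor \<open>q = 0\<close>.\<close>

lemma frobenius_ideal_closed_under_derivatives:
  fixes h :: "('n::finite, 'a::field) mpoly"
  assumes "CHAR('a) dvd q" "h \<in> frobenius_ideal q"
  shows "partial_deriv i h \<in> frobenius_ideal q"
proof -
  let ?t = "\<lambda>m. term_of (m - Poly_Mapping.single i 1) (of_nat (exponent m i) * coeff h m)"
  have "?t m \<in> frobenius_ideal q" if m: "m \<in> monomials h" for m
  proof (cases "of_nat (exponent m i) = (0::'a)")
    case True
    then show ?thesis by (simp add: mem_frobenius_ideal_iff)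
  next
    case False
    obtain j where j: "q \<le> exponent m j"
      using m assms(2) by (auto simp: mem_frobenius_ideal_iff)
    have "q \<noteq> exponent m i"
      using False assms(1) by (auto simp: of_nat_eq_0_iff_char_dvd)
    then have "q \<le> exponent (m - Poly_Mapping.single i 1) j"
      using j by (auto simp: lookup_minus lookup_single when_def)
    then show ?thesis
      by (auto simp: mem_frobenius_ideal_iff)
  qed
  then show ?thesis
    unfolding partial_deriv_def frobenius_ideal_def by (intro ideal_gen_sum)
qed

lemma monomials_partial_deriv:
  assumes "m \<in> monomials (partial_deriv i f)" "form w d f"
  shows "wt w m + w i = d"
proof -
  let ?t = "\<lambda>m. term_of (m - Poly_Mapping.single i 1) (of_nat (exponent m i) * coeff f m)"
  have "m \<in> (\<Union>k\<in>monomials f. monomials (?t k))"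
    using assms(1) keys_sum[of ?t "monomials f"] unfolding partial_deriv_def by blast
  then obtain k where k: "k \<in> monomials f" "m \<in> monomials (?t k)"
    by blast
  then have m: "m = k - Poly_Mapping.single i 1" and "exponent k i \<noteq> 0"
    by (auto split: if_splits intro: gr0I)
  then have "m + Poly_Mapping.single i 1 = k"
    by (intro poly_mapping_eqI) (auto simp: lookup_add lookup_minus lookup_single when_def)
  then have "wt w m + w i = wt w k"
    by (metis wt_add wt_single mult.right_neutral)
  then show ?thesis
    using k(1) assms(2) by (simp add: form_def)
qed

section \<open>Powers of a quasi-homogeneous isolated singularity\<close>

lemma partial_deriv_in_Jac: "partial_deriv i f \<in> Jac f"
  unfolding Jac_def by (intro ideal_gen_base rangeI)

lemma Jac_subset_radical: "Jac f \<subseteq> ideal_radical (Jac f)"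
  unfolding ideal_radical_def by (auto intro!: exI[of _ 1])

text \<open>Some power of \<open>x\<^sub>i\<close> lies in \<open>Jac f\<close>, so some \<open>\<partial>f/\<partial>x\<^sub>j\<close> contains a pure power of \<open>x\<^sub>i\<close>; it is
  not the zeroth power because \<open>Jac f\<close> lies in the maximal ideal. Thus \<open>f\<close> contains
  \<open>x\<^sub>j * x\<^sub>i ^ s\<close> with \<open>s \<ge> 1\<close>. The lemma makes the degrees \<open>d - w i\<close> of the partial derivatives genuine
  positive numbers.\<close>

lemma weight_less_degree:
  fixes f :: "('n::finite, 'a::field) mpoly"
  assumes "form w d f" and isolated: "ideal_radical (Jac f) = max_ideal" and w: "\<And>i. w i > 0"
  shows "w i < d"
proof -
  have "Var i \<in> ideal_radical (Jac f)"
    unfolding isolated max_ideal_def by (intro ideal_gen_base rangeI)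
  then obtain k where "Var i ^ k \<in> Jac f"
    by (auto simp: ideal_radical_def)
  then obtain r where "Var i ^ k = (\<Sum>j\<in>UNIV. r j * partial_deriv j f)"
    unfolding Jac_def ideal_gen_range_iff by blast
  then have "monomials (Var i ^ k :: ('n, 'a) mpoly) \<subseteq> (\<Union>j\<in>UNIV. monomials (r j * partial_deriv j f))"
    by (simp only: keys_sum)
  then obtain j where "Poly_Mapping.single i k \<in> monomials (r j * partial_deriv j f)"
    by (auto simp: Var_power)
  then obtain a m where m: "m \<in> monomials (partial_deriv j f)" "Poly_Mapping.single i k = a + m"
    using monomials_mult by blast
  have "partial_deriv j f \<in> max_ideal"
    using partial_deriv_in_Jac Jac_subset_radical isolated by blast
  then obtain l where l: "1 \<le> exponent m l"
    using m(1) unfolding max_ideal_eq_frobenius_ideal mem_frobenius_ideal_iff by blast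
  have "exponent (Poly_Mapping.single i k) l = exponent a l + exponent m l"
    by (simp add: m(2) lookup_add)
  then have "l = i"
    using l by (auto simp: lookup_single when_def split: if_splits)
  then have "w i \<le> w i * exponent m i"
    using l by simp
  also have "\<dots> \<le> wt w m"
    unfolding wt_def by (rule member_le_sum) auto
  also have "\<dots> < d"
    using monomials_partial_deriv[OF m(1) assms(1)] w[of j] by linarith
  finally show ?thesis .
qed

lemma form_power_notin_frobenius_ideal_le:
  fixes f :: "('n::finite, 'a::field) mpoly"
  assumes "form w d f" "f ^ N \<notin> frobenius_ideal q"
  shows "N * d \<le> (q - 1) * (\<Sum>i\<in>UNIV. w i)"
proof -
  obtain m where m: "m \<in> monomials (f ^ N)" "\<And>i. exponent m i < q"
    using assms(2) by (auto simp: mem_frobenius_ideal_iff not_le)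
  have "N * d = wt w m"
    using form_power[OF assms(1)] m(1) by (simp add: form_def)
  also have "\<dots> \<le> wt w (expo (\<lambda>_. q - 1))"
    unfolding wt_def
  proof (intro sum_mono mult_le_mono2)
    fix i show "exponent m i \<le> exponent (expo (\<lambda>_. q - 1)) i" using m(2)[of i] by simp
  qed
  finally show ?thesis
    by (simp only: wt_const)
qed

text \<open>Differentiating \<open>f ^ Suc N\<close> and cancelling the unit \<open>Suc N\<close> shows that \<open>Jac f\<close> multiplies \<open>f ^ N\<close> into the
  Frobenius ideal. The complement \<open>m'\<close> of a surviving monomial \<open>m\<close> moves it to the socle monomial
  \<open>x ^ (q - 1, \<dots>, q - 1)\<close>, so \<open>x ^ m'\<close> is not in \<open>Jac f\<close> and has at most the top degree of the
  complete intersection \<open>Jac f\<close>.\<close>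

lemma isolated_singularity_power_bound:
  fixes f :: "('n::finite, 'a::field) mpoly"
  assumes "prime CHAR('a)" "CHAR('a) dvd q"
    and f: "form w d f" and isolated: "ideal_radical (Jac f) = max_ideal" and w: "\<And>i. w i > 0"
    and notin: "f ^ N \<notin> frobenius_ideal q" and mem: "f ^ Suc N \<in> frobenius_ideal q"
    and N: "\<not> CHAR('a) dvd Suc N"
  shows "(q + 1) * (\<Sum>i\<in>UNIV. w i) \<le> (N + CARD('n)) * d"
proof -
  let ?\<sigma> = "\<Sum>i\<in>UNIV. w i"
  have wd: "w i < d" for i
    by (rule weight_less_degree[OF f isolated w])
  have "f ^ N * partial_deriv i f \<in> frobenius_ideal q" for i
  proof -
    let ?c = "of_nat (Suc N) :: 'a"
    have c: "?c \<noteq> 0"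
      using N by (simp only: of_nat_eq_0_iff_char_dvd not_False_eq_True)
    have "term_of 0 (inverse ?c) * partial_deriv i (f ^ Suc N) \<in> frobenius_ideal q"
      using frobenius_ideal_closed_under_derivatives[OF assms(2) mem]
      unfolding frobenius_ideal_def by (rule ideal_gen_mult)
    moreover have "term_of 0 (inverse ?c) * partial_deriv i (f ^ Suc N)
        = term_of 0 (inverse ?c * ?c) * (f ^ N * partial_deriv i f)"
      unfolding partial_deriv_power single_of_nat[symmetric] mult.assoc[symmetric] by (simp add: mult_single)
    ultimately show ?thesis
      using c by simp
  qed
  then have kill: "f ^ N * x \<in> frobenius_ideal q" if x: "x \<in> Jac f" for x
  proof -
    obtain r where "x = (\<Sum>i\<in>UNIV. r i * partial_deriv i f)"
      using x unfolding Jac_def ideal_gen_range_iff ..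
    then have "f ^ N * x = (\<Sum>i\<in>UNIV. r i * (f ^ N * partial_deriv i f))"
      by (simp add: sum_distrib_left mult_ac)
    then show ?thesis
      using \<open>\<And>i. f ^ N * partial_deriv i f \<in> frobenius_ideal q\<close>
      unfolding frobenius_ideal_def by (auto intro!: ideal_gen_sum intro: ideal_gen_mult)
  qed
  obtain m where m: "m \<in> monomials (f ^ N)" "\<And>i. exponent m i < q"
    using notin by (auto simp: mem_frobenius_ideal_iff not_le)
  define m' where "m' = expo (\<lambda>i. q - 1 - exponent m i)"
  have sum_m: "exponent (m + m') i = q - 1" for i
    using m(2)[of i] by (simp add: m'_def lookup_add)
  have "coeff (f ^ N * term_of m' 1) (m + m') \<noteq> 0"
    using m(1) by (simp add: coeff_mult_term in_keys_iff)
  then have "m + m' \<in> monomials (f ^ N * term_of m' 1)"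
    by (simp add: in_keys_iff)
  moreover have "exponent (m + m') i < q" for i
    using sum_m[of i] m(2)[of i] by linarith
  ultimately have "f ^ N * term_of m' 1 \<notin> frobenius_ideal q"
    unfolding mem_frobenius_ideal_iff by (meson not_le)
  then have notJ: "term_of m' 1 \<notin> ideal_gen (range (\<lambda>i. partial_deriv i f))"
    using kill unfolding Jac_def by blast
  have "\<exists>k. Var i ^ k \<in> ideal_gen (range (\<lambda>i. partial_deriv i f))" for i
  proof -
    have "Var i \<in> ideal_radical (Jac f)"
      unfolding isolated max_ideal_def by (intro ideal_gen_base rangeI)
    then show ?thesis
      by (auto simp: ideal_radical_def Jac_def)
  qed
  then obtain k where k: "\<And>i. Var i ^ k i \<in> ideal_gen (range (\<lambda>i. partial_deriv i f))"
    by metis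
  have deriv: "form w (d - w i) (partial_deriv i f)" for i
    unfolding form_def using monomials_partial_deriv[OF _ f] by fastforce
  have "wt w m' + ?\<sigma> \<le> (\<Sum>i\<in>UNIV. d - w i)"
    by (rule complete_intersection_top_degree[OF assms(1) deriv _ k notJ]) (use wd in simp)
  moreover have "(\<Sum>i\<in>UNIV. d - w i) + ?\<sigma> = CARD('n) * d"
    unfolding sum.distrib[symmetric] using wd by (simp add: less_imp_le)
  moreover have "wt w m = N * d"
    using form_power[OF f] m(1) by (simp add: form_def)
  moreover have "wt w m + wt w m' = (q - 1) * ?\<sigma>"
    unfolding wt_add[symmetric] wt_const[symmetric] by (simp add: wt_def sum_m)
  moreover have "q > 0"
    using m(2) by (metis gr_zeroI not_less_zero)
  ultimately show ?thesis
    by (cases q) (simp_all add: algebra_simps)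
qed

section \<open>The exponents \<open>\<nu>\<close>\<close>

lemma one_notin_frobenius_ideal: "q > 0 \<Longrightarrow> 1 \<notin> frobenius_ideal q"
  by (simp add: mem_frobenius_ideal_iff)

text \<open>The \<open>N\<close> with \<open>f ^ N\<close> outside the Frobenius ideal are closed downwards, contain \<open>0\<close>, and lie below
  \<open>q\<close>, so the maximum that defines \<open>nu\<close> is attained and determines them.\<close>

lemma le_nu_iff:
  fixes f :: "('n::finite, 'a::field) mpoly"
  assumes "prime CHAR('a)" "q = CHAR('a) ^ e" "f \<in> max_ideal"
  shows "N \<le> nu f q \<longleftrightarrow> f ^ N \<notin> frobenius_ideal q"
proof -
  have q: "q > 0"
    using assms(1,2) by (simp add: prime_gt_0_nat)
  let ?A = "{N. f ^ N \<notin> frobenius_ideal q}"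
  have down: "f ^ M \<in> frobenius_ideal q" if "f ^ N \<in> frobenius_ideal q" "N \<le> M" for M N
  proof -
    have "f ^ M = f ^ (M - N) * f ^ N"
      using that(2) by (simp flip: power_add)
    then show ?thesis
      using that(1) unfolding frobenius_ideal_def by (simp add: ideal_gen_mult)
  qed
  have "f ^ q \<in> frobenius_ideal q"
    using frobenius_ideal_power[OF assms(1,2), of f 1] assms(3)
    by (simp add: max_ideal_eq_frobenius_ideal)
  then have "?A \<subseteq> {..<q}"
    using down by (auto simp: not_less intro!: leI)
  then have fin: "finite ?A"
    by (rule finite_subset) simp
  have "0 \<in> ?A"
    using one_notin_frobenius_ideal[OF q] by simp
  then have "nu f q \<in> ?A"
    unfolding nu_def using fin by (metis Max_in empty_iff)
  moreover have "N \<le> nu f q" if "N \<in> ?A"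
    unfolding nu_def using fin that by (rule Max_ge)
  ultimately show ?thesis
    using down by auto
qed

lemma nu_superadditive:
  fixes f :: "('n::finite, 'a::field) mpoly"
  assumes "prime CHAR('a)" "f \<in> max_ideal"
  shows "nu f (CHAR('a) ^ s) + CHAR('a) ^ s * nu f (CHAR('a) ^ e) \<le> nu f (CHAR('a) ^ (s + e))"
proof -
  let ?q = "CHAR('a) ^ s" and ?Q = "CHAR('a) ^ e"
  have "f ^ nu f ?q \<notin> frobenius_ideal ?q" "f ^ nu f ?Q \<notin> frobenius_ideal ?Q"
    using le_nu_iff[OF assms(1) refl assms(2)] by blast+
  then have "f ^ nu f ?q * (f ^ nu f ?Q) ^ ?q \<notin> frobenius_ideal (?q * ?Q)"
    by (rule frobenius_mult_notin[OF assms(1) refl])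
  then have "f ^ (nu f ?q + ?q * nu f ?Q) \<notin> frobenius_ideal (CHAR('a) ^ (s + e))"
    by (simp add: power_add mult.commute[of ?q "nu f ?Q"] power_mult)
  then show ?thesis
    using le_nu_iff[OF assms(1) refl assms(2)] by blast
qed

lemma nu_subadditive:
  fixes f :: "('n::finite, 'a::field) mpoly"
  assumes "prime CHAR('a)" "f \<in> max_ideal"
  shows "nu f (CHAR('a) ^ (s + e)) + 1 \<le> CHAR('a) ^ s * (nu f (CHAR('a) ^ e) + 1)"
proof -
  let ?q = "CHAR('a) ^ s" and ?Q = "CHAR('a) ^ e"
  have "f ^ (nu f ?Q + 1) \<in> frobenius_ideal ?Q"
    using iffD2[OF le_nu_iff[OF assms(1) refl assms(2)], of "nu f ?Q + 1" e] by fastforce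
  then have "(f ^ (nu f ?Q + 1)) ^ ?q \<in> frobenius_ideal (?q * ?Q)"
    by (rule frobenius_ideal_power[OF assms(1) refl])
  then have "f ^ (?q * (nu f ?Q + 1)) \<in> frobenius_ideal (CHAR('a) ^ (s + e))"
    by (simp only: power_add mult.commute[of ?q "nu f ?Q + 1"] power_mult)
  then have "\<not> ?q * (nu f ?Q + 1) \<le> nu f (CHAR('a) ^ (s + e))"
    using le_nu_iff[OF assms(1) refl assms(2)] by blast
  then show ?thesis by simp
qed

lemma nu_quotient_tendsto_fpt:
  fixes f :: "('n::finite, 'a::field) mpoly"
  assumes "prime CHAR('a)" "f \<in> max_ideal"
  shows "(\<lambda>e. real (nu f (CHAR('a) ^ e)) / real (CHAR('a) ^ e)) \<longlonglongrightarrow> fpt f"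
proof -
  let ?p = "CHAR('a)"
  let ?x = "\<lambda>e. real (nu f (?p ^ e)) / real (?p ^ e)"
  have p: "?p > 0" using assms(1) by (simp add: prime_gt_0_nat)
  have "incseq ?x"
  proof (rule incseq_SucI)
    fix e
    have "?p * nu f (?p ^ e) \<le> nu f (?p ^ Suc e)"
      using nu_superadditive[OF assms, of 1 e] by simp
    then have "real ?p * real (nu f (?p ^ e)) \<le> real (nu f (?p ^ Suc e))"
      by (metis of_nat_le_iff of_nat_mult)
    then show "?x e \<le> ?x (Suc e)"
      using p by (simp add: field_simps)
  qed
  moreover have "?x e \<le> 1" for e
  proof -
    have "nu f (?p ^ e) + 1 \<le> ?p ^ e * (nu f (?p ^ 0) + 1)"
      using nu_subadditive[OF assms, of e 0] by simp
    moreover have "f \<in> frobenius_ideal 1"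
      using assms(2) by (simp add: max_ideal_eq_frobenius_ideal)
    then have "nu f (?p ^ 0) = 0"
      using le_nu_iff[OF assms(1) refl assms(2), of 1 0] by simp
    ultimately have "real (nu f (?p ^ e)) \<le> real (?p ^ e)"
      by simp
    then show ?thesis
      by (simp add: divide_le_eq)
  qed
  ultimately have "convergent ?x"
    using incseq_convergent[of ?x 1] convergentI by blast
  then show ?thesis
    unfolding fpt_def by (simp add: convergent_LIMSEQ_iff)
qed

section \<open>Non-terminating expansions\<close>

text \<open>A digit sequence is best handled through the integers \<open>P k\<close>, the \<open>k\<close>-th partial sums scaled
  by \<open>p ^ k\<close>: non-termination says exactly that \<open>P k\<close> is the largest integer strictly below
  \<open>\<alpha> * p ^ k\<close>, which pins down \<open>P\<close> and therefore the digits.\<close>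

lemma nonterminating_expansion_bounds:
  fixes c :: "nat \<Rightarrow> nat" and \<alpha> :: real
  assumes p: "p \<ge> 2" and c: "c 0 = 0" "\<And>e. e \<ge> 1 \<Longrightarrow> c e \<le> p - 1"
    and nonterm: "\<And>N. \<exists>e\<ge>N. c e \<noteq> 0" and sums: "(\<lambda>e. real (c e) / real p ^ e) sums \<alpha>"
  defines "P \<equiv> \<lambda>k. \<Sum>e\<le>k. c e * p ^ (k - e)"
  shows "real (P k) < \<alpha> * real p ^ k" "\<alpha> * real p ^ k \<le> real (P k) + 1"
    and "c (Suc k) = P (Suc k) - p * P k"
proof -
  define S where "S k = (\<Sum>e\<le>k. real (c e) / real p ^ e)" for k
  have p0: "real p > 0" using p by simp
  have P: "real (P k) = S k * real p ^ k" for k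
  proof -
    have "real (c e * p ^ (k - e)) = real (c e) / real p ^ e * real p ^ k" if "e \<le> k" for e
      using power_diff[OF _ that, of "real p"] p0 by simp
    then show ?thesis
      by (simp add: P_def S_def sum_distrib_right)
  qed
  have tend: "S \<longlonglongrightarrow> \<alpha>"
    using sums by (simp add: sums_def_le S_def[abs_def])
  have mono: "incseq S"
    by (intro incseq_SucI) (simp add: S_def)
  obtain e where e: "e \<ge> Suc k" "c e \<noteq> 0"
    using nonterm by blast
  obtain e' where e': "e = Suc e'" using e(1) by (cases e) auto
  have "S k \<le> S e'"
    using mono e(1) e' by (simp add: incseqD)
  also have "\<dots> < S e"
    using e(2) p0 by (simp add: S_def e')
  also have "\<dots> \<le> \<alpha>"
    using mono tend by (rule incseq_le)
  finally show "real (P k) < \<alpha> * real p ^ k"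
    using p0 by (simp add: P)
  \<comment> \<open>all digits equal to \<open>p - 1\<close> is the extreme case\<close>
  have step: "S (k + m) \<le> S k + 1 / real p ^ k - 1 / real p ^ (k + m)" for m
  proof (induction m)
    case (Suc m)
    have "real (c (Suc (k + m))) \<le> real p - 1"
      using c(2)[of "Suc (k + m)"] p by linarith
    then have "real (c (Suc (k + m))) / real p ^ Suc (k + m) \<le> (real p - 1) / real p ^ Suc (k + m)"
      using p0 by (intro divide_right_mono) auto
    also have "\<dots> = 1 / real p ^ (k + m) - 1 / real p ^ Suc (k + m)"
      using p0 by (simp add: field_simps)
    finally show ?case
      using Suc by (simp add: S_def)
  qed simp
  have "\<alpha> \<le> S k + 1 / real p ^ k"
  proof (rule LIMSEQ_le_const2[OF tend], intro exI allI impI)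
    fix m assume "k \<le> m"
    then have "S m \<le> S k + 1 / real p ^ k - 1 / real p ^ m"
      using step[of "m - k"] by simp
    then show "S m \<le> S k + 1 / real p ^ k"
      using p0 by (smt (verit) zero_less_divide_1_iff zero_less_power)
  qed
  then show "\<alpha> * real p ^ k \<le> real (P k) + 1"
    using p0 by (simp add: P field_simps)
  have "P (Suc k) = (\<Sum>e\<le>k. c e * p ^ (Suc k - e)) + c (Suc k)"
    by (simp add: P_def)
  also have "(\<Sum>e\<le>k. c e * p ^ (Suc k - e)) = p * P k"
    unfolding P_def sum_distrib_left by (intro sum.cong refl) (simp add: Suc_diff_le)
  finally show "c (Suc k) = P (Suc k) - p * P k" by simp
qed

lemma base_trunc_eq:
  fixes P :: "nat \<Rightarrow> nat" and \<alpha> :: real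
  assumes p: "p \<ge> 2" and \<alpha>: "\<alpha> \<le> 1"
    and lower: "\<And>k. real (P k) < \<alpha> * real p ^ k" and upper: "\<And>k. \<alpha> * real p ^ k \<le> real (P k) + 1"
  shows "base_trunc p \<alpha> L = real (P L) / real p ^ L"
proof -
  have p0: "real p > 0" using p by simp
  have P0: "P 0 = 0"
    using lower[of 0] \<alpha> by simp
  have ge: "p * P k \<le> P (Suc k)" for k
  proof -
    have "real p * real (P k) < real p * (\<alpha> * real p ^ k)"
      using lower[of k] p0 by simp
    also have "\<dots> \<le> real (P (Suc k)) + 1"
      using upper[of "Suc k"] by (simp add: mult_ac)
    finally have "p * P k < P (Suc k) + 1"
      by (metis of_nat_1 of_nat_add of_nat_less_iff of_nat_mult)
    then show ?thesis by simp
  qed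
  have le: "P (Suc k) \<le> p * P k + (p - 1)" for k
  proof -
    have "real (P (Suc k)) < real p * (\<alpha> * real p ^ k)"
      using lower[of "Suc k"] by (simp add: mult_ac)
    also have "\<dots> \<le> real p * (real (P k) + 1)"
      using upper[of k] p0 by (intro mult_left_mono) auto
    finally have "P (Suc k) < p * (P k + 1)"
      by (metis of_nat_1 of_nat_add of_nat_less_iff of_nat_mult)
    then show ?thesis
      using p by simp
  qed
  define c where "c e = (case e of 0 \<Rightarrow> 0 | Suc k \<Rightarrow> P (Suc k) - p * P k)" for e
  have c0: "c 0 = 0" and cS: "P (Suc k) = p * P k + c (Suc k)" for k
    using ge[of k] by (simp_all add: c_def)
  have partial: "(\<Sum>e\<le>k. real (c e) / real p ^ e) = real (P k) / real p ^ k" for k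
  proof (induction k)
    case (Suc k)
    then show ?case
      using p0 by (simp add: cS field_simps)
  qed (simp add: P0 c0)
  have digits: "nonterm_digits p \<alpha> = c"
    unfolding nonterm_digits_def
  proof (rule the_equality, intro conjI allI impI)
    show "c 0 = 0" by (rule c0)
    fix e :: nat assume "1 \<le> e"
    then obtain k where "e = Suc k" by (cases e) auto
    then show "c e \<le> p - 1" using le[of k] by (simp add: c_def)
  next
    fix N
    show "\<exists>e\<ge>N. c e \<noteq> 0"
    proof (rule ccontr)
      assume none: "\<not> (\<exists>e\<ge>N. c e \<noteq> 0)"
      have PN: "P (N + k) = p ^ k * P N" for k
        using none by (induction k) (auto simp: cS)
      \<comment> \<open>if the digits stop, the distance \<open>\<delta>\<close> is scaled by \<open>p\<close> in each step and outgrows \<open>1\<close>\<close>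
      define \<delta> where "\<delta> = \<alpha> * real p ^ N - real (P N)"
      have "\<delta> > 0" using lower[of N] by (simp add: \<delta>_def)
      have "real p ^ k \<le> 1 / \<delta>" for k
      proof -
        have "real p ^ k * \<delta> \<le> 1"
          using upper[of "N + k"] by (simp add: PN \<delta>_def power_add algebra_simps)
        then show ?thesis using \<open>\<delta> > 0\<close> by (simp add: field_simps)
      qed
      moreover obtain k where "1 / \<delta> < real p ^ k"
        using p real_arch_pow[of "real p"] by auto
      ultimately show False by (metis linorder_not_le)
    qed
  next
    have "(\<lambda>k. real (P k) / real p ^ k) \<longlonglongrightarrow> \<alpha>"
    proof (rule tendsto_sandwich)
      show "\<forall>\<^sub>F k in sequentially. \<alpha> - (1 / real p) ^ k \<le> real (P k) / real p ^ k"
      proof (intro always_eventually allI)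
        fix k
        have "\<alpha> * real p ^ k / real p ^ k \<le> (real (P k) + 1) / real p ^ k"
          using upper[of k] p0 by (intro divide_right_mono) auto
        then show "\<alpha> - (1 / real p) ^ k \<le> real (P k) / real p ^ k"
          using p0 by (simp add: add_divide_distrib power_one_over)
      qed
      show "\<forall>\<^sub>F k in sequentially. real (P k) / real p ^ k \<le> \<alpha>"
        using lower p0 by (auto simp: field_simps less_imp_le)
      have "(\<lambda>k. (1 / real p) ^ k) \<longlonglongrightarrow> 0"
        using p by (intro LIMSEQ_power_zero) auto
      then show "(\<lambda>k. \<alpha> - (1 / real p) ^ k) \<longlonglongrightarrow> \<alpha>"
        using tendsto_diff[OF tendsto_const, of _ 0 sequentially \<alpha>] by simp
    qed simp
    then show "(\<lambda>e. real (c e) / real p ^ e) sums \<alpha>"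
      by (simp add: sums_def_le partial)
  next
    fix c' :: "nat \<Rightarrow> nat"
    assume c': "c' 0 = 0 \<and> (\<forall>e\<ge>1. c' e \<le> p - 1) \<and> (\<forall>N. \<exists>e\<ge>N. c' e \<noteq> 0) \<and>
      (\<lambda>e. real (c' e) / real p ^ e) sums \<alpha>"
    define P' where "P' k = (\<Sum>e\<le>k. c' e * p ^ (k - e))" for k
    have c'_props: "c' 0 = 0" "\<And>e. e \<ge> 1 \<Longrightarrow> c' e \<le> p - 1" "\<And>N. \<exists>e\<ge>N. c' e \<noteq> 0"
      "(\<lambda>e. real (c' e) / real p ^ e) sums \<alpha>"
      using c' by auto
    note bounds = nonterminating_expansion_bounds[OF p c'_props, folded P'_def]
    have "real (P' k) < real (P k) + 1" "real (P k) < real (P' k) + 1" for k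
      using lower[of k] upper[of k] bounds(1,2)[of k] by linarith+
    then have "P' k < P k + 1" "P k < P' k + 1" for k
      by (metis of_nat_1 of_nat_add of_nat_less_iff)+
    then have "P' k = P k" for k
      by (simp add: le_antisym less_Suc_eq_le)
    then show "c' = c"
      using c'_props(1) bounds(3) by (auto simp: c_def split: nat.split)
  qed
  have "(\<Sum>e\<le>L. real (c e) / real p ^ e) = (\<Sum>e=1..L. real (c e) / real p ^ e)"
    by (rule sum.mono_neutral_right) (auto simp: c0 not_le)
  then show ?thesis
    by (simp add: base_trunc_def digits partial)
qed

section \<open>Least positive residues\<close>

lemma least_pos_residue_props:
  assumes "b > 0"
  shows "1 \<le> least_pos_residue m b" "least_pos_residue m b \<le> b"
    "[int (least_pos_residue m b) = m] (mod int b)"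
proof -
  define s where "s = nat ((m - 1) mod int b + 1)"
  have "0 \<le> (m - 1) mod int b" "(m - 1) mod int b < int b"
    using assms by simp_all
  then have s: "1 \<le> s" "s \<le> b" "int s = (m - 1) mod int b + 1"
    by (simp_all add: s_def)
  have "[int s = m] (mod int b)"
    unfolding s(3) cong_def by (simp add: mod_simps)
  then have ex: "1 \<le> s \<and> [int s = m] (mod int b)" using s(1) by simp
  show "1 \<le> least_pos_residue m b" "[int (least_pos_residue m b) = m] (mod int b)"
    unfolding least_pos_residue_def using LeastI[of "\<lambda>r. 1 \<le> r \<and> [int r = m] (mod int b)", OF ex] by auto
  show "least_pos_residue m b \<le> b"
    unfolding least_pos_residue_def
    using Least_le[of "\<lambda>r. 1 \<le> r \<and> [int r = m] (mod int b)", OF ex] s(2) by simp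
qed

lemma least_pos_residue_unique:
  assumes "1 \<le> r" "r \<le> b" "[int r = m] (mod int b)"
  shows "least_pos_residue m b = r"
proof -
  let ?l = "least_pos_residue m b"
  have b: "b > 0" using assms by simp
  note l = least_pos_residue_props[OF b, of m]
  have "[int ?l = int r] (mod int b)"
    using l(3) assms(3) by (metis cong_sym cong_trans)
  then have "int b dvd int ?l - int r"
    by (simp add: cong_iff_dvd_diff)
  moreover have "\<bar>int ?l - int r\<bar> < int b"
    using l(1,2) assms(1,2) by linarith
  ultimately have "int ?l - int r = 0"
    using dvd_imp_le_int[of "int ?l - int r" "int b"] by linarith
  then show ?thesis by simp
qed

lemma least_pos_residue_decomposition:
  assumes "b > 0" "m > 0"
  obtains t where "b * t + least_pos_residue (int m) b = m"
proof -
  let ?l = "least_pos_residue (int m) b"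
  have "?l \<le> m"
    unfolding least_pos_residue_def by (rule Least_le) (use assms in simp)
  moreover have "[m = ?l] (mod b)"
    using cong_sym[OF least_pos_residue_props(3)[OF assms(1), of "int m"]] by (simp only: cong_int_iff)
  ultimately have "\<exists>t. m = t * b + ?l"
    using cong_le_nat[of ?l m b] by (simp only:)
  then show ?thesis using that by (metis mult.commute)
qed

section \<open>Sequences with the growth of \<open>\<nu>\<close>\<close>

text \<open>The properties of \<open>\<nu> e = nu f (p ^ e)\<close> from which the arithmetic conclusions follow, with \<open>\<phi>\<close> for the
  \<open>F\<close>-pure threshold and \<open>a / b\<close> for \<open>lam\<close>. Assumption \<open>le\<close> reads \<open>\<nu> e \<le> (p ^ e - 1) * a / b\<close> and \<open>ge\<close>
  reads \<open>(p ^ e + 1) * a / b \<le> \<nu> e + n\<close>.\<close>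

locale threshold_sequence =
  fixes p a b n :: nat and \<nu> :: "nat \<Rightarrow> nat" and \<phi> :: real
  assumes p: "p \<ge> 2" and a: "1 \<le> a" "a \<le> b"
    and super: "\<nu> s + p ^ s * \<nu> e \<le> \<nu> (s + e)"
    and sub: "\<nu> (s + e) + 1 \<le> p ^ s * (\<nu> e + 1)"
    and le: "b * \<nu> e + a \<le> a * p ^ e"
    and ge: "e \<ge> 1 \<Longrightarrow> \<not> p dvd \<nu> e + 1 \<Longrightarrow> a * (p ^ e + 1) \<le> b * (\<nu> e + n)"
    and tendsto: "(\<lambda>e. real (\<nu> e) / real (p ^ e)) \<longlonglongrightarrow> \<phi>"
    and ne: "\<phi> \<noteq> real a / real b"
begin

definition r :: "nat \<Rightarrow> nat" where
  "r e = least_pos_residue (int (a * p ^ e)) b"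

text \<open>The truncation of \<open>a / b\<close> after \<open>e\<close> digits is \<open>T e / p ^ e\<close> (lemma \<open>base_trunc_T\<close>).\<close>

definition T :: "nat \<Rightarrow> nat" where
  "T e = (a * p ^ e - r e) div b"

lemma b: "b > 0"
  using a by simp

lemma p_power_pos: "real (p ^ e) > 0"
  using p by simp

lemma r_bounds: "1 \<le> r e" "r e \<le> b"
  unfolding r_def by (rule least_pos_residue_props[OF b])+

lemma T_eq: "b * T e + r e = a * p ^ e"
proof -
  have "a * p ^ e > 0"
    using a p by simp
  then obtain t where "b * t + r e = a * p ^ e"
    unfolding r_def using least_pos_residue_decomposition[OF b] by blast
  then show ?thesis
    using b unfolding T_def by (metis add_diff_cancel_right' nonzero_mult_div_cancel_left not_gr_zero)
qed

lemma T_bounds: "real (T e) < real a / real b * real p ^ e" "real a / real b * real p ^ e \<le> real (T e) + 1"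
proof -
  have eq: "real b * real (T e) + real (r e) = real a * real p ^ e"
    using arg_cong[OF T_eq[of e], of real] by simp
  show "real (T e) < real a / real b * real p ^ e" "real a / real b * real p ^ e \<le> real (T e) + 1"
    using eq r_bounds[of e] b by (simp_all add: field_simps)
qed

lemma base_trunc_T: "base_trunc p (real a / real b) L = real (T L) / real p ^ L"
  using p a T_bounds by (intro base_trunc_eq) (simp_all add: divide_le_eq)

lemma \<nu>_le_T: "\<nu> e \<le> T e"
proof -
  have "b * \<nu> e < b * (T e + 1)"
    using le[of e] T_eq[of e] r_bounds[of e] a by simp
  then have "\<nu> e < T e + 1"
    by (simp only: mult_less_cancel1)
  then show ?thesis by simp
qed

lemma lower_\<phi>: "real (\<nu> e) / real (p ^ e) \<le> \<phi>"
proof (rule LIMSEQ_le_const[OF tendsto], intro exI allI impI)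
  fix k assume "e \<le> k"
  then have "p ^ (k - e) * \<nu> e \<le> \<nu> k"
    using super[of "k - e" e] by simp
  then have "real (p ^ (k - e) * \<nu> e) \<le> real (\<nu> k)"
    by (rule of_nat_mono)
  then have "real p ^ (k - e) * real (\<nu> e) \<le> real (\<nu> k)"
    by simp
  moreover have "real p ^ k = real p ^ e * real p ^ (k - e)"
    using \<open>e \<le> k\<close> by (simp flip: power_add)
  ultimately show "real (\<nu> e) / real (p ^ e) \<le> real (\<nu> k) / real (p ^ k)"
    using p_power_pos[of e] p_power_pos[of "k - e"] by (simp add: field_simps)
qed

lemma upper_\<phi>: "\<phi> \<le> (real (\<nu> e) + 1) / real (p ^ e)"
proof (rule LIMSEQ_le_const2[OF tendsto], intro exI allI impI)
  fix k assume "e \<le> k"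
  then have "\<nu> k \<le> p ^ (k - e) * (\<nu> e + 1)"
    using sub[of "k - e" e] by simp
  then have "real (\<nu> k) \<le> real (p ^ (k - e) * (\<nu> e + 1))"
    by (rule of_nat_mono)
  then have "real (\<nu> k) \<le> real p ^ (k - e) * (real (\<nu> e) + 1)"
    by (simp add: algebra_simps)
  moreover have "real p ^ k = real p ^ e * real p ^ (k - e)"
    using \<open>e \<le> k\<close> by (simp flip: power_add)
  ultimately show "real (\<nu> k) / real (p ^ k) \<le> (real (\<nu> e) + 1) / real (p ^ e)"
    using p_power_pos[of e] p_power_pos[of "k - e"] by (simp add: field_simps)
qed

lemma \<phi>_less: "\<phi> < real a / real b"
proof -
  have "\<phi> \<le> real a / real b"
  proof (rule LIMSEQ_le_const2[OF tendsto], intro exI allI impI)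
    fix k
    have "real (b * \<nu> k) \<le> real (a * p ^ k)"
      using le[of k] by (intro of_nat_mono) simp
    then show "real (\<nu> k) / real (p ^ k) \<le> real a / real b"
      using b p_power_pos[of k] by (simp add: field_simps)
  qed
  then show ?thesis using ne by simp
qed

text \<open>Assumption \<open>le\<close> gives \<open>a \<le> r e\<close>. If \<open>r e = a\<close>, then \<open>\<nu> e\<close> attains the upper bound \<open>(p ^ e - 1) * a / b\<close>. Superadditivity carries this
  equality to all multiples of \<open>e\<close>, so that \<open>\<phi> = a / b\<close> in the limit.\<close>

lemma no_return:
  assumes "e \<ge> 1" "\<nu> e = T e"
  shows "a < r e"
proof -
  have "a \<le> r e"
    using le[of e] T_eq[of e] assms(2) by simp
  moreover have "r e \<noteq> a"
  proof
    assume "r e = a"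
    then have eq: "b * \<nu> e + a = a * p ^ e"
      using T_eq[of e] assms(2) by simp
    have grow: "a * p ^ (k * e) \<le> b * \<nu> (k * e) + a" for k
    proof (induction k)
      case (Suc k)
      have "a * p ^ (Suc k * e) = a * p ^ (k * e) * p ^ e"
        by (simp add: power_add)
      also have "\<dots> \<le> (b * \<nu> (k * e) + a) * p ^ e"
        using Suc by simp
      also have "\<dots> = b * (p ^ e * \<nu> (k * e)) + a * p ^ e"
        by (simp add: algebra_simps)
      also have "\<dots> = b * (\<nu> e + p ^ e * \<nu> (k * e)) + a"
        using eq by (simp add: algebra_simps)
      also have "\<dots> \<le> b * \<nu> (Suc k * e) + a"
        using super[of e "k * e"] by simp
      finally show ?case .
    qed simp
    have bound: "real (p ^ (k * e)) * (real a / real b - \<phi>) \<le> 1" for k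
    proof -
      have "real (a * p ^ (k * e)) \<le> real (b * \<nu> (k * e) + a)"
        using grow by (rule of_nat_mono)
      then have "real a / real b * real (p ^ (k * e)) \<le> real (\<nu> (k * e)) + real a / real b"
        using b by (simp add: field_simps)
      moreover have "real a / real b \<le> 1"
        using a b by simp
      moreover have "real (\<nu> (k * e)) \<le> \<phi> * real (p ^ (k * e))"
        using lower_\<phi>[of "k * e"] p_power_pos[of "k * e"] by (simp add: divide_le_eq)
      ultimately show ?thesis
        by (simp add: algebra_simps)
    qed
    obtain k where k: "1 / (real a / real b - \<phi>) < real k"
      using reals_Archimedean2 by blast
    have "k < p ^ (k * e)"
    proof -
      have "k \<le> k * e" using assms(1) by simp
      also have "\<dots> < p ^ (k * e)"
        using p by (intro power_gt_expt) simp
      finally show ?thesis .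
    qed
    then have "real k < real (p ^ (k * e))"
      by (simp only: of_nat_less_iff)
    with k have "1 / (real a / real b - \<phi>) < real (p ^ (k * e))"
      by linarith
    then have "1 < real (p ^ (k * e)) * (real a / real b - \<phi>)"
      using \<phi>_less by (simp add: divide_less_eq)
    then show False
      using bound[of k] by simp
  qed
  ultimately show ?thesis by simp
qed

text \<open>Where \<open>e \<ge> 1\<close> and \<open>p\<close> does not divide \<open>\<nu> e + 1\<close>, assumption \<open>ge\<close> bounds \<open>p ^ e * (a / b - \<phi>)\<close> by \<open>n\<close>, so this
  happens for finitely many \<open>e\<close>. It does happen, since otherwise \<open>\<nu> e + 1 = p ^ e\<close> for all \<open>e\<close> and
  \<open>\<phi> = 1\<close>. After the last such \<open>e\<close> the quotient \<open>(\<nu> e + 1) / p ^ e\<close> is constant.\<close>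

lemma last_exponent:
  obtains L where "L \<ge> 1" "\<not> p dvd \<nu> L + 1" "\<phi> = (real (\<nu> L) + 1) / real (p ^ L)"
proof -
  define X where "X = {e. e \<ge> 1 \<and> \<not> p dvd \<nu> e + 1}"
  have maximal_digit: "\<nu> (Suc e) + 1 = p * (\<nu> e + 1)" if maximal: "p dvd \<nu> (Suc e) + 1" for e
  proof -
    have lower: "p * \<nu> e \<le> \<nu> (Suc e)" and upper: "\<nu> (Suc e) + 1 \<le> p * (\<nu> e + 1)"
      using super[of 1 e] sub[of 1 e] by simp_all
    obtain k where k: "\<nu> (Suc e) + 1 = p * k"
      using maximal by (elim dvdE)
    have "p * \<nu> e < p * k"
      using lower k by linarith
    then have "\<nu> e < k"
      by (simp only: mult_less_cancel1)
    then have "p * (\<nu> e + 1) \<le> p * k"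
      by (intro mult_le_mono2) simp
    then show ?thesis
      using upper k by simp
  qed
  have limit: "\<phi> \<ge> (real (\<nu> L) + 1) / real (p ^ L)" if L: "\<And>e. e > L \<Longrightarrow> p dvd \<nu> e + 1" for L
  proof -
    have \<nu>: "\<nu> (L + k) + 1 = p ^ k * (\<nu> L + 1)" for k
    proof (induction k)
      case (Suc k)
      then show ?case
        using maximal_digit[of "L + k"] L[of "Suc (L + k)"] by (simp add: algebra_simps)
    qed simp
    have "(real (\<nu> L) + 1) / real (p ^ L) - (1 / real p) ^ k \<le> \<phi>" for k
    proof -
      have "real (\<nu> (L + k) + 1) = real (p ^ k) * (real (\<nu> L) + 1)"
        unfolding \<nu> by (simp add: algebra_simps)
      then have \<nu>': "real (\<nu> (L + k)) = real (p ^ k) * (real (\<nu> L) + 1) - 1"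
        by simp
      have "real (\<nu> (L + k)) / real (p ^ (L + k)) = (real (\<nu> L) + 1) / real (p ^ L) - 1 / real (p ^ (L + k))"
        unfolding \<nu>' power_add of_nat_mult diff_divide_distrib using p_power_pos[of k] by simp
      moreover have "1 / real (p ^ (L + k)) \<le> (1 / real p) ^ k"
        using p by (simp add: power_add power_one_over divide_simps)
      ultimately show ?thesis
        using lower_\<phi>[of "L + k"] by linarith
    qed
    moreover have "(\<lambda>k. (real (\<nu> L) + 1) / real (p ^ L) - (1 / real p) ^ k) \<longlonglongrightarrow> (real (\<nu> L) + 1) / real (p ^ L) - 0"
      using p by (intro tendsto_diff tendsto_const LIMSEQ_power_zero) simp
    ultimately show ?thesis
      using LIMSEQ_le_const2 by fastforce
  qed
  have "X \<noteq> {}"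
  proof
    assume "X = {}"
    then have "\<phi> \<ge> (real (\<nu> 0) + 1) / real (p ^ 0)"
      by (intro limit) (auto simp: X_def)
    then have "\<phi> \<ge> 1"
      by simp
    moreover have "real a / real b \<le> 1"
      using a by (simp add: divide_le_eq)
    ultimately show False
      using \<phi>_less by linarith
  qed
  moreover have "finite X"
  proof -
    obtain K where K: "real n / (real a / real b - \<phi>) < real K"
      using reals_Archimedean2 by blast
    have "e < K" if "e \<in> X" for e
    proof -
      have "real (a * (p ^ e + 1)) \<le> real (b * (\<nu> e + n))"
        using that ge[of e] by (intro of_nat_mono) (simp add: X_def)
      then have "real a / real b * real (p ^ e) + real a / real b \<le> real (\<nu> e) + real n"
        using b by (simp add: field_simps)
      moreover have "real (\<nu> e) \<le> \<phi> * real (p ^ e)"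
        using lower_\<phi>[of e] p_power_pos[of e] by (simp add: divide_le_eq)
      moreover have "real a / real b \<ge> 0" by simp
      moreover have "real (p ^ e) * (real a / real b - \<phi>) = real a / real b * real (p ^ e) - \<phi> * real (p ^ e)"
        by (simp add: algebra_simps)
      ultimately have "real (p ^ e) * (real a / real b - \<phi>) \<le> real n"
        by linarith
      then have "real (p ^ e) \<le> real n / (real a / real b - \<phi>)"
        using \<phi>_less by (simp add: le_divide_eq)
      moreover have "e < p ^ e"
        using p by (intro power_gt_expt) simp
      then have "real e < real (p ^ e)"
        by (simp only: of_nat_less_iff)
      ultimately show ?thesis using K by linarith
    qed
    then show ?thesis
      by (meson finite_lessThan finite_subset lessThan_iff subsetI)
  qed
  ultimately have Max: "Max X \<in> X" "\<And>e. e \<in> X \<Longrightarrow> e \<le> Max X"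
    by auto
  have "\<phi> \<ge> (real (\<nu> (Max X)) + 1) / real (p ^ Max X)"
  proof (rule limit)
    fix e assume "e > Max X"
    then show "p dvd \<nu> e + 1"
      using Max(2)[of e] by (force simp: X_def)
  qed
  then show ?thesis
    using that[of "Max X"] Max(1) upper_\<phi>[of "Max X"] by (simp add: X_def)
qed

text \<open>A deficit \<open>\<nu> e + 1 \<le> T e\<close> is multiplied by \<open>p ^ (L - e)\<close> on the way to \<open>L\<close>, and indivisibility of
  \<open>\<nu> L + 1\<close> costs one more. Together with assumption \<open>ge\<close> at \<open>L\<close> this leaves only \<open>p \<le> (n - 2) * b\<close>.\<close>

lemma \<nu>_eq_T_below:
  assumes "L \<ge> 1" "\<not> p dvd \<nu> L + 1" "e < L" and large: "int p > (int n - 2) * int b"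
  shows "\<nu> e = T e"
proof (rule ccontr)
  assume "\<nu> e \<noteq> T e"
  then have "\<nu> e + 1 \<le> T e"
    using \<nu>_le_T[of e] by simp
  define q where "q = p ^ (L - e)"
  have L: "p ^ L = q * p ^ e"
    using assms(3) by (simp add: q_def flip: power_add)
  have "p dvd q"
    using assms(3) by (simp add: q_def)
  have "p \<le> q"
    using \<open>p dvd q\<close> p by (intro dvd_imp_le) (auto simp: q_def)
  have "\<nu> L + 1 \<le> q * (\<nu> e + 1)"
    using sub[of "L - e" e] assms(3) by (simp add: q_def)
  moreover have "\<nu> L + 1 \<noteq> q * (\<nu> e + 1)"
    using assms(2) \<open>p dvd q\<close> by (metis dvd_mult2)
  ultimately have "\<nu> L + 2 \<le> q * (\<nu> e + 1)"
    by linarith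
  also have "\<dots> \<le> q * T e"
    using \<open>\<nu> e + 1 \<le> T e\<close> by (rule mult_le_mono2)
  finally have "b * (\<nu> L + 2) + q * r e \<le> q * (b * T e + r e)"
    by (metis add_mult_distrib2 add_right_mono mult.left_commute mult_le_mono2)
  also have "\<dots> = a * p ^ L"
    by (simp add: T_eq L)
  also have "\<dots> + a \<le> b * (\<nu> L + n)"
    using ge[OF assms(1,2)] by (simp add: distrib_left)
  finally have "2 * b + q * r e + a \<le> b * n"
    by (simp add: distrib_left)
  moreover have "p \<le> q * r e"
    using \<open>p \<le> q\<close> r_bounds(1)[of e] by (metis mult.right_neutral mult_le_mono)
  ultimately have "2 * b + p \<le> b * n"
    by linarith
  then have "2 * int b + int p \<le> int b * int n"
    by (metis of_nat_add of_nat_le_iff of_nat_mult of_nat_numeral)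
  then show False
    using large by (simp add: algebra_simps)
qed

text \<open>Take \<open>E = T L - \<nu> L - 1\<close>. It is nonnegative because \<open>\<nu> L = T L\<close> would put \<open>\<phi>\<close> at
  \<open>(T L + 1) / p ^ L \<ge> a / b\<close>.\<close>

lemma threshold_formula:
  assumes "L \<ge> 1" "\<not> p dvd \<nu> L + 1" and \<phi>: "\<phi> = (real (\<nu> L) + 1) / real (p ^ L)"
  obtains E where "r L + a + b * E \<le> b * (n - 1)" "n \<ge> 1"
    "\<phi> = real a / real b - real (r L + b * E) / real (b * p ^ L)"
    "\<phi> = base_trunc p (real a / real b) L - real E / real (p ^ L)"
proof -
  have "\<nu> L \<noteq> T L"
  proof
    assume eq: "\<nu> L = T L"
    have "\<phi> * real (p ^ L) = real (T L) + 1"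
      using p_power_pos[of L] by (simp add: \<phi> eq)
    moreover have "\<phi> * real (p ^ L) < real a / real b * real (p ^ L)"
      using \<phi>_less p_power_pos[of L] by (rule mult_strict_right_mono)
    ultimately show False
      using T_bounds(2)[of L] by simp
  qed
  then obtain E where E: "T L = \<nu> L + E + 1"
    using \<nu>_le_T[of L] by (metis Suc_eq_plus1 add_Suc_right le_neq_implies_less less_imp_Suc_add)
  have "a * p ^ L + a \<le> b * \<nu> L + b * n"
    using ge[OF assms(1,2)] by (simp add: distrib_left)
  then have le: "r L + a + b * E + b \<le> b * n"
    using T_eq[of L] by (simp add: E algebra_simps)
  have n: "n \<ge> 1"
    using le a by (cases n) auto
  have real_T: "real b * real (T L) + real (r L) = real a * real (p ^ L)"
    using arg_cong[OF T_eq[of L], of real] by simp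
  have "real (T L) = real (\<nu> L) + real E + 1"
    by (simp add: E)
  then have \<phi>': "\<phi> = (real (T L) - real E) / real (p ^ L)"
    by (simp add: \<phi>)
  show ?thesis
  proof
    show "r L + a + b * E \<le> b * (n - 1)"
      using le by (simp add: diff_mult_distrib2)
    show "n \<ge> 1" by (rule n)
    show "\<phi> = base_trunc p (real a / real b) L - real E / real (p ^ L)"
      by (simp add: \<phi>' base_trunc_T diff_divide_distrib)
    have "real a / real b = (real b * real (T L) + real (r L)) / real (b * p ^ L)"
      using p_power_pos[of L] by (simp add: real_T)
    then have "real a / real b - real (r L + b * E) / real (b * p ^ L)
        = real b * (real (T L) - real E) / (real b * real (p ^ L))"
      by (simp add: diff_divide_distrib[symmetric] right_diff_distrib)
    also have "\<dots> = \<phi>"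
      using b by (simp only: \<phi>' mult_divide_mult_cancel_left of_nat_eq_0_iff neq0_conv)
    finally show "\<phi> = real a / real b - real (r L + b * E) / real (b * p ^ L)" ..
  qed
qed

end

text \<open>A power of \<open>p\<close> cannot be absorbed by factors between \<open>1\<close> and \<open>p - 1\<close>.\<close>

lemma exponent_pair_unique:
  fixes p x x' L L' :: nat
  assumes p: "p \<ge> 2" and x: "1 \<le> x" "x < p" and x': "1 \<le> x'" "x' < p"
    and eq: "x * p ^ L' = x' * p ^ L"
  shows "L = L'"
proof -
  have aux: "\<not> L < L'" if x: "1 \<le> x" and x': "x' < p" and eq: "x * p ^ L' = x' * p ^ L" for x x' L L' :: nat
  proof
    assume "L < L'"
    then have "p ^ L' = p ^ (L' - L) * p ^ L"
      by (simp flip: power_add)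
    then have "x * p ^ (L' - L) = x'"
      using eq p by (simp add: mult.assoc[symmetric])
    moreover have "p \<le> p ^ (L' - L)"
      using \<open>L < L'\<close> p by (intro self_le_power) auto
    ultimately have "p \<le> x'"
      using x by (metis le_trans mult_le_mono1 nat_mult_1)
    then show False using x' by simp
  qed
  show ?thesis
    using aux[OF x(1) x'(2) eq] aux[OF x'(1) x(2) eq[symmetric]] by linarith
qed

theorem theorem3p5:
  fixes f :: "('n::finite, 'a::field) mpoly"
    and w :: "'n \<Rightarrow> nat"
    and p d a b n :: nat
    and lam :: real
    and C :: "nat \<Rightarrow> nat \<Rightarrow> bool"
  assumes char: "CHAR('a) = p" "p > 0"
    and n_def: "n = CARD('n)"
    and grading: "\<And>i. w i > 0"
    and hom: "homogeneous w d f"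
    and isolated: "ideal_radical (Jac f) = max_ideal"
    and lam_def: "lam = min (real (\<Sum>i\<in>UNIV. w i) / real d) 1"
    and lam_frac: "lam = real a / real b" "b > 0" "coprime a b"
    and ne: "fpt f \<noteq> lam"
  defines "C \<equiv> \<lambda>L E.
      L \<ge> 1 \<and>
      int E \<le> int n - 1 -
        \<lceil>real (least_pos_residue (int (a * p ^ L)) b + a) / real b\<rceil> \<and>
      fpt f = lam - real (least_pos_residue (int (a * p ^ L)) b + b * E) / real (b * p ^ L) \<and>
      fpt f = base_trunc p lam L - real E / real (p ^ L)"
  shows "\<exists>L E. C L E \<and>
      (int p > (int n - 2) * int b \<and> \<not> p dvd b \<longrightarrow> 1 \<le> L \<and> L \<le> ord b p) \<and>
      (int p > (int n - 2) * int b \<and> p > b \<longrightarrow>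
         (\<forall>e. 1 \<le> e \<and> e \<le> L - 1 \<longrightarrow> a < least_pos_residue (int (a * p ^ e)) b)) \<and>
      (int p > (int n - 1) * int b \<longrightarrow> (\<exists>!(L', E'). C L' E'))"
proof -
  let ?\<sigma> = "\<Sum>i\<in>UNIV. w i"
  have prime: "prime p"
    using prime_CHAR_semidom[where 'a = 'a] char by simp
  note prime' = prime[folded char(1)]
  have p2: "p \<ge> 2"
    using prime by (rule prime_ge_2_nat)
  have form: "form w d f"
    using hom by (simp add: homogeneous_def form_def wt_def)
  have wd: "w i < d" for i
    by (rule weight_less_degree[OF form isolated grading])
  then have d: "d > 0"
    by (rule le_less_trans[OF le0])
  have f_max: "f \<in> max_ideal"
    unfolding max_ideal_eq_frobenius_ideal mem_frobenius_ideal_iff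
  proof
    fix m assume "m \<in> monomials f"
    then have "wt w m \<noteq> 0"
      using form d by (simp add: form_def)
    then show "\<exists>i. 1 \<le> exponent m i"
      by (auto simp: wt_def Suc_le_eq)
  qed
  have \<sigma>: "?\<sigma> > 0"
    using grading by (simp add: sum_pos)
  have "lam > 0"
    using \<sigma> d unfolding lam_def min_less_iff_conj by (simp del: of_nat_sum)
  then have a1: "a \<ge> 1"
    using lam_frac(1) by (cases a) auto
  have "lam \<le> 1"
    by (simp add: lam_def)
  then have ab: "a \<le> b"
    using lam_frac(1,2) by (simp add: divide_le_eq)
  have ad: "a * d \<le> b * ?\<sigma>"
  proof -
    have "real a / real b \<le> real ?\<sigma> / real d"
      using lam_def lam_frac(1) by simp
    then have "real (a * d) \<le> real (b * ?\<sigma>)"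
      using d lam_frac(2) by (simp add: divide_simps mult_ac)
    then show ?thesis
      by (simp only: of_nat_le_iff)
  qed
  \<comment> \<open>if \<open>?\<sigma> > d\<close>, then \<open>lam = 1\<close>, and the bound on \<open>\<nu>\<close> comes from \<open>f ^ q \<in> frobenius_ideal q\<close> instead of degrees\<close>
  have ad_cases: "a * d = b * ?\<sigma> \<or> a = b"
  proof -
    have "real a / real b = real ?\<sigma> / real d \<or> real a / real b = 1"
      unfolding lam_frac(1)[symmetric] lam_def by (simp add: min_def)
    then have "real (a * d) = real (b * ?\<sigma>) \<or> real a = real b"
      using d lam_frac(2) by (auto simp: divide_simps mult_ac)
    then show ?thesis
      by (simp only: of_nat_eq_iff)
  qed
  define \<nu> where "\<nu> e = nu f (p ^ e)" for e
  have le_\<nu>_iff: "N \<le> \<nu> e \<longleftrightarrow> f ^ N \<notin> frobenius_ideal (p ^ e)" for N e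
    unfolding \<nu>_def using le_nu_iff[OF prime' refl f_max] by (simp add: char)
  have super: "\<nu> s + p ^ s * \<nu> e \<le> \<nu> (s + e)" and sub: "\<nu> (s + e) + 1 \<le> p ^ s * (\<nu> e + 1)" for s e
    unfolding \<nu>_def using nu_superadditive[OF prime' f_max] nu_subadditive[OF prime' f_max] by (simp_all add: char)
  interpret threshold_sequence p a b n \<nu> "fpt f"
  proof
    show "p \<ge> 2" "1 \<le> a" "a \<le> b" by (fact p2 a1 ab)+
    show "\<nu> s + p ^ s * \<nu> e \<le> \<nu> (s + e)" "\<nu> (s + e) + 1 \<le> p ^ s * (\<nu> e + 1)" for s e
      by (fact super sub)+
    show "b * \<nu> e + a \<le> a * p ^ e" for e
    proof -
      have q: "p ^ e > 0" using p2 by simp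
      have "b * \<nu> e \<le> a * (p ^ e - 1)"
        using ad_cases
      proof
        assume eq: "a * d = b * ?\<sigma>"
        have "\<nu> e * d \<le> (p ^ e - 1) * ?\<sigma>"
          using form_power_notin_frobenius_ideal_le[OF form] le_\<nu>_iff by blast
        then have "b * (\<nu> e * d) \<le> b * ((p ^ e - 1) * ?\<sigma>)"
          by (rule mult_le_mono2)
        also have "\<dots> = (p ^ e - 1) * (a * d)"
          by (simp add: eq mult_ac)
        finally have "(b * \<nu> e) * d \<le> (a * (p ^ e - 1)) * d"
          by (simp only: mult_ac)
        then show ?thesis
          using d by simp
      next
        assume "a = b"
        have "\<nu> 0 = 0"
          using le_\<nu>_iff[of 1 0] f_max by (simp add: max_ideal_eq_frobenius_ideal)
        then have "\<nu> e \<le> p ^ e - 1"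
          using sub[of e 0] by simp
        then show ?thesis
          unfolding \<open>a = b\<close> by (rule mult_le_mono2)
      qed
      moreover have "a * (p ^ e - 1) + a = a * p ^ e"
        using q by (cases "p ^ e") simp_all
      ultimately show ?thesis
        by linarith
    qed
    show "a * (p ^ e + 1) \<le> b * (\<nu> e + n)" if "e \<ge> 1" "\<not> p dvd \<nu> e + 1" for e
    proof -
      have "(p ^ e + 1) * ?\<sigma> \<le> (\<nu> e + CARD('n)) * d"
      proof (rule isolated_singularity_power_bound[OF prime' _ form isolated grading])
        show "CHAR('a) dvd p ^ e" using char that(1) by simp
        show "f ^ \<nu> e \<notin> frobenius_ideal (p ^ e)" "f ^ Suc (\<nu> e) \<in> frobenius_ideal (p ^ e)"
          using le_\<nu>_iff[of "\<nu> e" e] le_\<nu>_iff[of "Suc (\<nu> e)" e] by auto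
        show "\<not> CHAR('a) dvd Suc (\<nu> e)" using that(2) char by simp
      qed
      then have "b * ((p ^ e + 1) * ?\<sigma>) \<le> b * ((\<nu> e + n) * d)"
        unfolding n_def by (rule mult_le_mono2)
      moreover have "(p ^ e + 1) * (a * d) \<le> (p ^ e + 1) * (b * ?\<sigma>)"
        using ad by (rule mult_le_mono2)
      ultimately have "(a * (p ^ e + 1)) * d \<le> (b * (\<nu> e + n)) * d"
        by (simp only: mult_ac)
      then show ?thesis
        using d by simp
    qed
    show "(\<lambda>e. real (\<nu> e) / real (p ^ e)) \<longlonglongrightarrow> fpt f"
      unfolding \<nu>_def using nu_quotient_tendsto_fpt[OF prime' f_max] by (simp add: char)
    show "fpt f \<noteq> real a / real b"
      using ne lam_frac(1) by simp
  qed
  have C_iff: "C L E \<longleftrightarrow> L \<ge> 1 \<and> r L + a + b * E \<le> b * (n - 1) \<and> n \<ge> 1 \<and>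
      fpt f = real a / real b - real (r L + b * E) / real (b * p ^ L) \<and>
      fpt f = base_trunc p (real a / real b) L - real E / real (p ^ L)" for L E
  proof -
    have n: "n \<ge> 1"
      unfolding n_def by (simp add: Suc_le_eq)
    have "int E \<le> int n - 1 - \<lceil>real (r L + a) / real b\<rceil> \<longleftrightarrow>
        \<lceil>real (r L + a) / real b\<rceil> \<le> int n - 1 - int E"
      by linarith
    also have "\<dots> \<longleftrightarrow> real (r L + a) \<le> real_of_int (int n - 1 - int E) * real b"
      using lam_frac(2) by (simp add: ceiling_le_iff divide_le_eq)
    also have "\<dots> \<longleftrightarrow> real (r L + a + b * E) \<le> real (b * (n - 1))"
      using n by (simp add: of_nat_diff algebra_simps)
    also have "\<dots> \<longleftrightarrow> r L + a + b * E \<le> b * (n - 1)"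
      by (simp only: of_nat_le_iff)
    finally show ?thesis
      using n unfolding C_def lam_frac(1) r_def by simp
  qed
  obtain L where L: "L \<ge> 1" "\<not> p dvd \<nu> L + 1" "fpt f = (real (\<nu> L) + 1) / real (p ^ L)"
    using last_exponent by blast
  obtain E where E: "C L E"
    using threshold_formula[OF L] L(1) unfolding C_iff by metis
  have above: "a < r e" if "int p > (int n - 2) * int b" "1 \<le> e" "e < L" for e
    using no_return[OF that(2)] \<nu>_eq_T_below[OF L(1,2) that(3,1)] by blast
  have "L \<le> ord b p" if "int p > (int n - 2) * int b" "\<not> p dvd b"
  proof (rule ccontr)
    assume "\<not> L \<le> ord b p"
    moreover have "coprime b p"
      using prime_imp_coprime[OF prime that(2)] by (simp add: coprime_commute)
    then have "ord b p \<ge> 1" "[p ^ ord b p = 1] (mod b)"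
      using coprime_ord by (auto simp: Suc_le_eq)
    moreover from this(2) have "[int a = int (a * p ^ ord b p)] (mod int b)"
      using cong_scalar_left[of "p ^ ord b p" 1 b a] by (simp only: cong_int_iff cong_sym_eq mult_1_right)
    then have "r (ord b p) = a"
      unfolding r_def by (rule least_pos_residue_unique[OF a1 ab])
    ultimately show False
      using above[OF that(1), of "ord b p"] by simp
  qed
  moreover have "\<exists>!(L', E'). C L' E'" if large: "int p > (int n - 1) * int b"
  proof (rule ex1I[of _ "(L, E)"])
    show "case (L, E) of (L', E') \<Rightarrow> C L' E'" using E by simp
    fix z assume "case z of (L', E') \<Rightarrow> C L' E'"
    then obtain L' E' where z: "z = (L', E')" and C': "C L' E'"
      by (cases z) auto
    \<comment> \<open>in this range the numerators of \<open>lam - fpt f\<close> over \<open>b * p ^ L\<close> lie strictly between \<open>0\<close> and \<open>p\<close>\<close>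
    have less: "r L + b * E < p" "1 \<le> r L + b * E" if "C L E" for L E
    proof -
      have "n \<ge> 1" "r L + a + b * E \<le> b * (n - 1)"
        using that by (simp_all add: C_iff)
      moreover have "int (b * (n - 1)) < int p"
        using large \<open>n \<ge> 1\<close> by (simp add: of_nat_diff mult.commute)
      ultimately show "r L + b * E < p" "1 \<le> r L + b * E"
        using r_bounds(1)[of L] by linarith+
    qed
    have "real (r L + b * E) / real (b * p ^ L) = real (r L' + b * E') / real (b * p ^ L')"
      using E C' unfolding C_iff by linarith
    then have "real ((r L + b * E) * p ^ L') = real ((r L' + b * E') * p ^ L)"
      using p2 lam_frac(2) by (simp add: frac_eq_eq mult_ac)
    then have eq: "(r L + b * E) * p ^ L' = (r L' + b * E') * p ^ L"
      by (simp only: of_nat_eq_iff)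
    have "L = L'"
      by (rule exponent_pair_unique[OF p2 less(2,1)[OF E] less(2,1)[OF C'] eq])
    then show "z = (L, E)"
      using eq p2 lam_frac(2) by (simp add: z)
  qed
  ultimately show ?thesis
    using E L(1) above unfolding r_def by (intro exI[of _ L] exI[of _ E]) auto
qed

end
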